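(* Set $\xi(t,\theta):=\log\big(1+h(t,(\cos\theta,\sin\theta))\big)$ and $\chi(t,\theta):=\psi(t,(\cos\theta,\sin\theta))$. Then the system on $\mathbb S^1$ $$\partial_th=\frac{\sqrt{(1+h)^2+|\nabla_{\mathbb S^1}h|^2}}{1+h}\,G(h)\psi,$$ $$\partial_t\psi=\frac12\Big(G(h)\psi+\frac{\langle\nabla_{\mathbb S^1}\psi,\nabla_{\mathbb S^1}h\rangle}{(1+h)\sqrt{(1+h)^2+|\nabla_{\mathbb S^1}h|^2}}\Big)^2-\frac{|\nabla_{\mathbb S^1}\psi|^2}{2(1+h)^2}-\sigma_0(H(h)-1)$$ can be written on $(t,\theta)\in\mathbb R\times\mathbb T^1$ as $$\partial_t\xi=e^{-2\xi}\,\tilde G(\xi)\chi,$$ $$\partial_t\chi=e^{-2\xi}\Big[\frac12\Big(\frac{\tilde G(\xi)\chi+\xi'\chi'}{\sqrt{1+\xi'^2}}\Big)^2-\frac12\chi'^2+\sigma_0e^{\xi}\Big(\frac{\xi'}{\sqrt{1+\xi'^2}}\Big)'\Big]-\sigma_0\Big[e^{-\xi}\frac1{\sqrt{1+\xi'^2}}-1\Big].$$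
   Context: $\sigma_0$ is a constant; all functions are sufficiently smooth. $\mathbb S^1$ is the unit circle in $\mathbb R^2$, $\mathbb T^1=\mathbb R/2\pi\mathbb Z$, a prime denotes $\partial_\theta$, and $\nabla_{\mathbb S^1}$ is the tangential gradient on $\mathbb S^1$. $h(t,\cdot):\mathbb S^1\to(-1,+\infty)$, $\psi(t,\cdot):\mathbb S^1\to\mathbb R$. For fixed $h:\mathbb S^1\to(-1,\infty)$ let $\gamma_h(x)=(1+h(x))x$, let $\Omega_h$ be the bounded star-shaped domain with boundary $\gamma_h(\mathbb S^1)$, $\nu_h$ its outward unit normal, and $H(h)$ the curvature of $\partial\Omega_h$ (equal to $1$ for the unit circle) pulled back to $\mathbb S^1$ by $\gamma_h$. $G(h)\psi:=\langle\nabla\Phi\circ\gamma_h,\nu_h\circ\gamma_h\rangle$, where $\Delta\Phi=0$ in $\Omega_h$, $\Phi\circ\gamma_h=\psi$ on $\mathbb S^1$ (with $\nabla\Phi$ bounded in $\Omega_h$). For $\xi,\chi:\mathbb T^1\to\mathbb R$ let $\Omega_\xi=\{(\rho,\theta)\in\mathbb R\times\mathbb T^1:\rho<\xi(\theta)\}$ and let $\tilde\Phi$ solve $\Delta\tilde\Phi=0$ in $\Omega_\xi$, $\tilde\Phi(\xi(\theta),\theta)=\chi(\theta)$, $\partial_\rho\tilde\Phi(\rho,\theta)\to0$ as $\rho\to-\infty$. The infinite-depth Dirichlet–Neumann operator on the torus is $\tilde G(\xi)\chi(\theta):=\partial_\rho\tilde\Phi(\xi(\theta),\theta)-\xi'(\theta)\partial_\theta\tilde\Phi(\xi(\theta),\theta)$.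 *)

theory Defs
  imports "HOL-Analysis.Analysis"
begin

text \<open>
  The plane is the Euclidean space \<open>real \<times> real\<close>, the unit circle is \<open>sphere 0 1\<close> in it.
  Functions on the circle are functions on the plane of which only the values on the circle are
  used; functions on the torus \<open>\<real> / 2\<pi>\<int>\<close> are \<open>2\<pi>\<close>-periodic functions on \<open>\<real>\<close>.
\<close>

text \<open>
  \<open>V\<close> is the gradient of the \<open>C\<^sup>1\<close> function \<open>\<Phi>\<close> on \<open>S\<close>. With \<open>S\<close> the closure of a
  domain with \<open>C\<^sup>1\<close> boundary, this says that \<open>\<Phi>\<close> is \<open>C\<^sup>1\<close> up to the boundary, and
  \<open>V\<close> is determined by \<open>\<Phi>\<close> also at boundary points.
\<close>
definition has_gradient_on ::
  "('a::euclidean_space \<Rightarrow> real) \<Rightarrow> ('a \<Rightarrow> 'a) \<Rightarrow> 'a set \<Rightarrow> bool" where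
  "has_gradient_on \<Phi> V S \<longleftrightarrow>
     continuous_on S V \<and> (\<forall>p\<in>S. (\<Phi> has_derivative (\<lambda>v. V p \<bullet> v)) (at p within S))"

text \<open>
  For open \<open>U\<close>: \<open>\<Phi>\<close> is \<open>C\<^sup>2\<close> and its Laplacian, the trace of the derivative \<open>D\<close> of the
  gradient \<open>V\<close>, vanishes.
\<close>
definition harmonic_on :: "('a::euclidean_space \<Rightarrow> real) \<Rightarrow> 'a set \<Rightarrow> bool" where
  "harmonic_on \<Phi> U \<longleftrightarrow> (\<exists>V D.
     (\<forall>p\<in>U. (GDERIV \<Phi> p :> V p) \<and> (V has_derivative D p) (at p)) \<and>
     (\<forall>v. continuous_on U (\<lambda>p. D p v)) \<and>
     (\<forall>p\<in>U. (\<Sum>b\<in>Basis. D p b \<bullet> b) = 0))"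

definition C2_on_circle :: "(real \<times> real \<Rightarrow> real) \<Rightarrow> bool" where
  "C2_on_circle f \<longleftrightarrow> (\<exists>f' f''.
     (\<forall>\<theta>. ((\<lambda>\<theta>. f (cos \<theta>, sin \<theta>)) has_real_derivative f' \<theta>) (at \<theta>) \<and>
          (f' has_real_derivative f'' \<theta>) (at \<theta>)) \<and>
     continuous_on UNIV f'')"

text \<open>The tangential gradient: the tangent vector representing the derivative along the circle.\<close>
definition circle_grad :: "(real \<times> real \<Rightarrow> real) \<Rightarrow> real \<times> real \<Rightarrow> real \<times> real" where
  "circle_grad f x =
     (THE g. g \<bullet> x = 0 \<and> (f has_derivative (\<lambda>v. g \<bullet> v)) (at x within sphere 0 1))"

definition bdry :: "(real \<times> real \<Rightarrow> real) \<Rightarrow> real \<times> real \<Rightarrow> real \<times> real" where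
  "bdry h x = (1 + h x) *\<^sub>R x"

definition star_domain :: "(real \<times> real \<Rightarrow> real) \<Rightarrow> (real \<times> real) set" where
  "star_domain h = {r *\<^sub>R x | r x. x \<in> sphere 0 1 \<and> 0 \<le> r \<and> r < 1 + h x}"

text \<open>
  The limit says that \<open>n\<close> is orthogonal to the tangent space of the boundary at \<open>p\<close>: the
  directions of the secants of the boundary through \<open>p\<close> become orthogonal to \<open>n\<close>.
\<close>
definition outer_normal :: "'a::euclidean_space set \<Rightarrow> 'a \<Rightarrow> 'a" where
  "outer_normal S p = (THE n. norm n = 1 \<and>
     ((\<lambda>q. n \<bullet> sgn (q - p)) \<longlongrightarrow> 0) (at p within frontier S) \<and>
     (\<forall>\<^sub>F s in at_right 0. p + s *\<^sub>R n \<notin> closure S))"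

text \<open>Signed curvature of a regular planar curve; positive for counterclockwise circles.\<close>
definition plane_curvature :: "(real \<Rightarrow> real \<times> real) \<Rightarrow> real \<Rightarrow> real" where
  "plane_curvature c s =
     (let c' = (\<lambda>s. vector_derivative c (at s)); c'' = vector_derivative c' (at s)
      in (fst (c' s) * snd c'' - snd (c' s) * fst c'') / norm (c' s) ^ 3)"

text \<open>
  The boundary is parametrized counterclockwise, starting at the image of \<open>x\<close>: the point
  \<open>cos s *\<^sub>R x + sin s *\<^sub>R (- snd x, fst x)\<close> is \<open>x\<close> rotated by the angle \<open>s\<close>.
\<close>
definition curvature_at :: "(real \<times> real \<Rightarrow> real) \<Rightarrow> real \<times> real \<Rightarrow> real" where
  "curvature_at h x =
     plane_curvature (\<lambda>s. bdry h (cos s *\<^sub>R x + sin s *\<^sub>R (- snd x, fst x))) 0"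

definition disc_potential ::
  "(real \<times> real \<Rightarrow> real) \<Rightarrow> (real \<times> real \<Rightarrow> real) \<Rightarrow>
   (real \<times> real \<Rightarrow> real) \<Rightarrow> (real \<times> real \<Rightarrow> real \<times> real) \<Rightarrow> bool" where
  "disc_potential h \<psi> \<Phi> V \<longleftrightarrow>
     has_gradient_on \<Phi> V (closure (star_domain h)) \<and>
     harmonic_on \<Phi> (star_domain h) \<and>
     (\<forall>x\<in>sphere 0 1. \<Phi> (bdry h x) = \<psi> x) \<and>
     bounded (V ` star_domain h)"

text \<open>
  For \<open>C\<^sup>2\<close> data (with \<open>h > -1\<close>) the Dirichlet problem has a unique solution that is \<open>C\<^sup>1\<close> up
  to the boundary. Only where it has no such solution is the operator given the default value 0
  (as for the library's \<open>integral\<close>); likewise for the operator on the torus.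
\<close>
definition DN_circle ::
  "(real \<times> real \<Rightarrow> real) \<Rightarrow> (real \<times> real \<Rightarrow> real) \<Rightarrow> real \<times> real \<Rightarrow> real" where
  "DN_circle h \<psi> x =
     (if \<exists>\<Phi> V. disc_potential h \<psi> \<Phi> V
      then THE g. \<exists>\<Phi> V. disc_potential h \<psi> \<Phi> V \<and>
                       g = V (bdry h x) \<bullet> outer_normal (star_domain h) (bdry h x)
      else 0)"

text \<open>Points are \<open>(\<rho>, \<theta>)\<close>; the domain is lifted to the universal cover of \<open>\<real> \<times> \<real> / 2\<pi>\<int>\<close>.\<close>
definition below_graph :: "(real \<Rightarrow> real) \<Rightarrow> (real \<times> real) set" where
  "below_graph \<xi> = {(\<rho>, \<theta>). \<rho> < \<xi> \<theta>}"

text \<open>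
  The decay of \<open>\<partial>\<^sub>\<rho>\<Phi>\<close> as \<open>\<rho> \<rightarrow> -\<infinity>\<close> is required uniformly in \<open>\<theta>\<close>:
  pointwise decay would not determine \<open>\<Phi>\<close>.
\<close>
definition torus_potential ::
  "(real \<Rightarrow> real) \<Rightarrow> (real \<Rightarrow> real) \<Rightarrow>
   (real \<times> real \<Rightarrow> real) \<Rightarrow> (real \<times> real \<Rightarrow> real \<times> real) \<Rightarrow> bool" where
  "torus_potential \<xi> chi \<Phi> V \<longleftrightarrow>
     (\<forall>\<rho> \<theta>. \<Phi> (\<rho>, \<theta> + 2 * pi) = \<Phi> (\<rho>, \<theta>)) \<and>
     has_gradient_on \<Phi> V (closure (below_graph \<xi>)) \<and>
     harmonic_on \<Phi> (below_graph \<xi>) \<and>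
     (\<forall>\<theta>. \<Phi> (\<xi> \<theta>, \<theta>) = chi \<theta>) \<and>
     uniform_limit UNIV (\<lambda>\<rho> \<theta>. fst (V (\<rho>, \<theta>))) (\<lambda>\<theta>. 0) at_bot"

definition DN_torus :: "(real \<Rightarrow> real) \<Rightarrow> (real \<Rightarrow> real) \<Rightarrow> real \<Rightarrow> real" where
  "DN_torus \<xi> chi \<theta> =
     (if \<exists>\<Phi> V. torus_potential \<xi> chi \<Phi> V
      then THE g. \<exists>\<Phi> V. torus_potential \<xi> chi \<Phi> V \<and>
                       g = fst (V (\<xi> \<theta>, \<theta>)) - deriv \<xi> \<theta> * snd (V (\<xi> \<theta>, \<theta>))
      else 0)"

end

theory Submission
  imports Defs "HOL-Complex_Analysis.Complex_Analysis" "HOL-Real_Asymp.Real_Asymp"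
begin

text \<open>
  The exponential maps the region \<open>{Re z < \<xi> (Im z)}\<close> conformally onto the punctured star-shaped
  domain, so it pulls a solution \<open>\<Phi>\<close> of the Dirichlet problem in the disc-like domain back to a
  solution in the half-cylinder, and multiplies its gradient by \<open>\<bar>exp z\<bar>\<close>; this relates the two
  Dirichlet-Neumann operators by the factor \<open>exp (- \<xi>) / sqrt (1 + \<xi>'\<^sup>2)\<close>. Conversely, a
  periodic solution in the half-cylinder descends to the punctured domain, and the decay of
  \<open>\<partial>\<^sub>\<rho>\<Phi>\<close> makes the puncture a removable singularity of the holomorphic function
  \<open>\<partial>\<^sub>1\<Phi> - \<i> \<partial>\<^sub>2\<Phi>\<close>. Uniqueness is the maximum principle. With \<open>1 + h = exp \<xi>\<close> the remaining
  terms of the two systems agree pointwise by direct computation.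
\<close>

section \<open>Gradients of harmonic functions as holomorphic functions\<close>

text \<open>Gradients, closures and normals are given in \<open>real \<times> real\<close>, with
  one-sided derivatives at the boundary. In complex terms a potential is a pair (f, g) with df = Re
  (g dz), where g is holomorphic inside and continuous up to the boundary, and both operators become
  real parts of boundary values of g times explicit factors. No solvability theorem for the
  Dirichlet problem is invoked. Solutions on the two sides are put in correspondence, so either one
  g computes both operators or both take their default value 0. The delicate direction leads from
  the half-cylinder to the disc. A singular part l / w of g at the puncture would contribute Re (l
  log w) to the potential. Decay of the \<rho>-derivative excludes the real part of l, a logarithmic
  source; periodicity in \<theta> excludes its imaginary part, a circulation. Both are needed, as
  the harmonic functions \<rho> and \<theta> show. The half-cylinder is unbounded, so uniqueness
  there is reduced to the disc, whose closure is compact.\<close>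

lemma second_difference_bound:
  fixes \<Phi> :: "'a::real_inner \<Rightarrow> real"
  assumes r: "r > 0" and \<Phi>: "\<And>q. dist q p < r \<Longrightarrow> (\<Phi> has_derivative (\<lambda>v. V q \<bullet> v)) (at q)"
    and V: "\<And>y. norm y < r \<Longrightarrow> norm (V (p + y) - V p - A y) \<le> \<epsilon> * norm y"
    and A: "linear A" and s: "s > 0" "s * (norm u + norm v) < r" and \<epsilon>: "\<epsilon> \<ge> 0"
  shows "\<bar>\<Phi> (p + s *\<^sub>R u + s *\<^sub>R v) - \<Phi> (p + s *\<^sub>R u) - \<Phi> (p + s *\<^sub>R v) + \<Phi> p - s\<^sup>2 * (A v \<bullet> u)\<bar>
         \<le> 2 * \<epsilon> * s\<^sup>2 * (norm u + norm v)\<^sup>2"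
proof -
  have small: "norm (\<tau> *\<^sub>R s *\<^sub>R u + \<kappa> *\<^sub>R s *\<^sub>R v) \<le> s * (norm u + norm v)"
    if "0 \<le> \<tau>" "\<tau> \<le> 1" "0 \<le> \<kappa>" "\<kappa> \<le> 1" for \<tau> \<kappa>
  proof -
    have "norm (\<tau> *\<^sub>R s *\<^sub>R u + \<kappa> *\<^sub>R s *\<^sub>R v) \<le> \<tau> * (s * norm u) + \<kappa> * (s * norm v)"
      using that s norm_triangle_ineq[of "\<tau> *\<^sub>R s *\<^sub>R u" "\<kappa> *\<^sub>R s *\<^sub>R v"] by (simp add: abs_mult)
    also have "\<dots> \<le> 1 * (s * norm u) + 1 * (s * norm v)"
      using that s by (intro add_mono mult_right_mono) auto
    finally show ?thesis by (simp add: algebra_simps)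
  qed
  \<comment> \<open>\<open>k\<close> is the increment of \<Phi> in the direction v, as a function of
    the position in the direction u. The mean value theorem for \<open>k\<close> leaves a difference
    of two values of the gradient; expanding \<open>V\<close> at p in both produces the factor 2 of
    the bound.\<close>
  define k where "k \<tau> = \<Phi> (p + \<tau> *\<^sub>R s *\<^sub>R u + s *\<^sub>R v) - \<Phi> (p + \<tau> *\<^sub>R s *\<^sub>R u)" for \<tau>
  define k' where "k' \<tau> = (V (p + \<tau> *\<^sub>R s *\<^sub>R u + s *\<^sub>R v) - V (p + \<tau> *\<^sub>R s *\<^sub>R u)) \<bullet> (s *\<^sub>R u)" for \<tau>
  have k: "(k has_real_derivative k' \<tau>) (at \<tau>)" if \<tau>: "0 \<le> \<tau>" "\<tau> \<le> 1" for \<tau>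
  proof -
    have d1: "(\<Phi> has_derivative (\<bullet>) (V (p + \<tau> *\<^sub>R s *\<^sub>R u + s *\<^sub>R v))) (at (p + \<tau> *\<^sub>R s *\<^sub>R u + s *\<^sub>R v))"
      using small[of \<tau> 1] \<tau> s by (intro \<Phi>) (auto simp: dist_norm algebra_simps)
    have d2: "(\<Phi> has_derivative (\<bullet>) (V (p + \<tau> *\<^sub>R s *\<^sub>R u))) (at (p + \<tau> *\<^sub>R s *\<^sub>R u))"
      using small[of \<tau> 0] \<tau> s by (intro \<Phi>) (auto simp: dist_norm algebra_simps)
    have d1': "((\<lambda>\<tau>. \<Phi> (p + \<tau> *\<^sub>R s *\<^sub>R u + s *\<^sub>R v)) has_derivative
        (\<lambda>x. V (p + \<tau> *\<^sub>R s *\<^sub>R u + s *\<^sub>R v) \<bullet> (x *\<^sub>R s *\<^sub>R u))) (at \<tau>)"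
      by (rule has_derivative_compose[where g = \<Phi> and f = "\<lambda>\<tau>. p + \<tau> *\<^sub>R s *\<^sub>R u + s *\<^sub>R v", OF _ d1])
         (auto intro!: derivative_eq_intros)
    have d2': "((\<lambda>\<tau>. \<Phi> (p + \<tau> *\<^sub>R s *\<^sub>R u)) has_derivative
        (\<lambda>x. V (p + \<tau> *\<^sub>R s *\<^sub>R u) \<bullet> (x *\<^sub>R s *\<^sub>R u))) (at \<tau>)"
      by (rule has_derivative_compose[where g = \<Phi> and f = "\<lambda>\<tau>. p + \<tau> *\<^sub>R s *\<^sub>R u", OF _ d2])
         (auto intro!: derivative_eq_intros)
    have "(k has_derivative (\<lambda>x. x * k' \<tau>)) (at \<tau>)"
      using has_derivative_diff[OF d1' d2'] unfolding k_def k'_def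
      by (simp add: algebra_simps inner_diff_left)
    then show ?thesis
      by (simp add: has_field_derivative_def mult.commute[of _ "k' \<tau>"])
  qed
  obtain \<tau> where \<tau>: "0 < \<tau>" "\<tau> < 1" "k 1 - k 0 = (1 - 0) * k' \<tau>"
    using MVT2[of 0 1 k k'] k by auto
  define y1 y2 where "y1 = \<tau> *\<^sub>R s *\<^sub>R u + s *\<^sub>R v" and "y2 = \<tau> *\<^sub>R s *\<^sub>R u"
  have n1: "norm y1 \<le> s * (norm u + norm v)" and n2: "norm y2 \<le> s * (norm u + norm v)"
    using small[of \<tau> 1] small[of \<tau> 0] \<tau> by (auto simp: y1_def y2_def)
  have "A y1 - A y2 = s *\<^sub>R A v"
    using A by (simp add: y1_def y2_def linear_add linear_cmul)
  then have "norm (V (p + y1) - V (p + y2) - s *\<^sub>R A v)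
      = norm ((V (p + y1) - V p - A y1) - (V (p + y2) - V p - A y2))"
    by (simp add: algebra_simps)
  also have "\<dots> \<le> \<epsilon> * norm y1 + \<epsilon> * norm y2"
    using V[of y1] V[of y2] n1 n2 s
    by (intro order_trans[OF norm_triangle_ineq4[of "V (p + y1) - V p - A y1"]] add_mono) auto
  also have "\<dots> \<le> 2 * \<epsilon> * (s * (norm u + norm v))"
    using mult_left_mono[OF n1 \<epsilon>] mult_left_mono[OF n2 \<epsilon>] by simp
  finally have *: "norm (V (p + y1) - V (p + y2) - s *\<^sub>R A v) \<le> 2 * \<epsilon> * (s * (norm u + norm v))" .
  have "\<bar>k' \<tau> - s\<^sup>2 * (A v \<bullet> u)\<bar> = \<bar>(V (p + y1) - V (p + y2) - s *\<^sub>R A v) \<bullet> (s *\<^sub>R u)\<bar>"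
    by (simp add: k'_def y1_def y2_def power2_eq_square algebra_simps inner_diff_left)
  also have "\<dots> \<le> norm (V (p + y1) - V (p + y2) - s *\<^sub>R A v) * norm (s *\<^sub>R u)"
    by (rule Cauchy_Schwarz_ineq2)
  also have "\<dots> \<le> (2 * \<epsilon> * (s * (norm u + norm v))) * (s * (norm u + norm v))"
    using s \<epsilon> by (intro mult_mono *) auto
  finally show ?thesis
    using \<tau>(3) by (simp add: k_def power2_eq_square algebra_simps)
qed

text \<open>The second difference of \<Phi> is symmetric in u and v, and after division by
  \<open>s\<^sup>2\<close> it is close both to \<open>A v \<bullet> u\<close> and to
  \<open>A u \<bullet> v\<close>. This is Young's form of the symmetry of second derivatives; it
  supplies one of the two Cauchy-Riemann equations for the gradient.\<close>

lemma gradient_derivative_symmetric: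
  fixes \<Phi> :: "'a::real_inner \<Rightarrow> real"
  assumes U: "open U" "p \<in> U" and \<Phi>: "\<And>q. q \<in> U \<Longrightarrow> (\<Phi> has_derivative (\<lambda>v. V q \<bullet> v)) (at q)"
    and V: "(V has_derivative A) (at p)"
  shows "A v \<bullet> u = A u \<bullet> v"
proof (rule ccontr)
  assume ne: "A v \<bullet> u \<noteq> A u \<bullet> v"
  have lin: "linear A"
    using V has_derivative_linear by blast
  define M where "M = (norm u + norm v)\<^sup>2"
  define K where "K = M + 1"
  define \<epsilon> where "\<epsilon> = \<bar>A v \<bullet> u - A u \<bullet> v\<bar> / (8 * K)"
  have M: "M \<ge> 0" by (simp add: M_def)
  then have K: "K > 0" by (simp add: K_def)
  have \<epsilon>: "\<epsilon> > 0" using ne K by (simp add: \<epsilon>_def)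
  obtain d1 where d1: "d1 > 0" "\<And>y. norm (y - p) < d1 \<Longrightarrow> norm (V y - V p - A (y - p)) \<le> \<epsilon> * norm (y - p)"
    using V \<epsilon> unfolding has_derivative_at_alt by blast
  obtain d2 where d2: "d2 > 0" "ball p d2 \<subseteq> U"
    using U openE by blast
  define r where "r = min d1 d2"
  have r: "r > 0" using d1 d2 by (simp add: r_def)
  define N where "N = norm u + norm v"
  define s where "s = r / (2 * (N + 1))"
  have N: "N \<ge> 0" by (simp add: N_def)
  then have s: "s > 0" using r by (simp add: s_def)
  have "s * N < s * (2 * (N + 1))"
    using N s by (intro mult_strict_left_mono) simp_all
  also have "\<dots> = r"
    using N unfolding s_def by simp
  finally have s': "s * (norm u + norm v) < r" by (simp add: N_def)
  have D: "(\<Phi> has_derivative (\<lambda>v. V q \<bullet> v)) (at q)" if "dist q p < r" for q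
    using that d2 by (intro \<Phi>) (auto simp: r_def dist_commute)
  have B: "norm (V (p + y) - V p - A y) \<le> \<epsilon> * norm y" if "norm y < r" for y
    using d1(2)[of "p + y"] that by (simp add: r_def)
  define \<Delta> where "\<Delta> = \<Phi> (p + s *\<^sub>R u + s *\<^sub>R v) - \<Phi> (p + s *\<^sub>R u) - \<Phi> (p + s *\<^sub>R v) + \<Phi> p"
  have 1: "\<bar>\<Delta> - s\<^sup>2 * (A v \<bullet> u)\<bar> \<le> 2 * \<epsilon> * s\<^sup>2 * M"
    unfolding \<Delta>_def M_def using second_difference_bound[OF r D B lin s s'] \<epsilon> by simp
  have 2: "\<bar>\<Delta> - s\<^sup>2 * (A u \<bullet> v)\<bar> \<le> 2 * \<epsilon> * s\<^sup>2 * M"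
    unfolding \<Delta>_def M_def
    using second_difference_bound[OF r D B lin s, of v u] s' \<epsilon> by (simp add: algebra_simps)
  have "s\<^sup>2 * \<bar>A v \<bullet> u - A u \<bullet> v\<bar> = \<bar>s\<^sup>2 * (A v \<bullet> u) - s\<^sup>2 * (A u \<bullet> v)\<bar>"
    by (simp add: abs_mult flip: right_diff_distrib)
  also have "\<dots> \<le> s\<^sup>2 * (4 * \<epsilon> * M)"
    using 1 2 by (simp add: abs_le_iff algebra_simps)
  finally have "\<bar>A v \<bullet> u - A u \<bullet> v\<bar> \<le> 4 * \<epsilon> * M"
    using s by simp
  moreover have "\<bar>A v \<bullet> u - A u \<bullet> v\<bar> = 8 * \<epsilon> * K"
    using K by (simp add: \<epsilon>_def)
  moreover have "4 * \<epsilon> * M < 8 * \<epsilon> * K"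
    by (rule mult_strict_mono') (use M \<epsilon> in \<open>auto simp: K_def\<close>)
  ultimately show False by linarith
qed

section \<open>The plane identified with the complex numbers\<close>

definition cpx :: "real \<times> real \<Rightarrow> complex" where "cpx p = Complex (fst p) (snd p)"
definition pt :: "complex \<Rightarrow> real \<times> real" where "pt z = (Re z, Im z)"

lemma cpx_pt [simp]: "cpx (pt z) = z" and pt_cpx [simp]: "pt (cpx p) = p"
  by (simp_all add: cpx_def pt_def)

lemma Re_cpx [simp]: "Re (cpx p) = fst p" and Im_cpx [simp]: "Im (cpx p) = snd p"
  and fst_pt [simp]: "fst (pt z) = Re z" and snd_pt [simp]: "snd (pt z) = Im z"
  by (simp_all add: cpx_def pt_def)

lemma bounded_linear_cpx: "bounded_linear cpx"
  by (intro linear_conv_bounded_linear[THEN iffD1] linearI) (auto simp: complex_eq_iff)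

lemma bounded_linear_pt: "bounded_linear pt"
  by (intro linear_conv_bounded_linear[THEN iffD1] linearI) (auto simp: prod_eq_iff)

lemma inj_cpx: "inj cpx"
  by (metis injI pt_cpx)

lemma pt_image_cpx [simp]: "pt ` cpx ` S = S"
  by (simp add: image_image)

lemma norm_cpx [simp]: "norm (cpx p) = norm p"
  by (simp add: cmod_def norm_prod_def)

lemma open_cpx_image: "open (cpx ` S)" if "open S"
proof -
  have "cpx ` S = pt -` S" by (auto simp: image_iff) (metis cpx_pt)
  then show ?thesis
    using that bounded_linear.continuous_on[OF bounded_linear_pt continuous_on_id] by (simp add: open_vimage)
qed

lemma closure_cpx_image: "closure (cpx ` S) = cpx ` closure S"
  using closure_injective_linear_image[of cpx S] bounded_linear_cpx inj_cpx
  by (simp add: linear_conv_bounded_linear)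

lemma inner_pt: "pt z \<bullet> pt w = Re (cnj z * w)"
  by (simp add: pt_def)

text \<open>The gradient \<open>(a, b)\<close> is encoded by the complex number \<open>a - \<i>b\<close>, so that holomorphic
  changes of variables act on it by multiplication with the derivative.\<close>
definition cgrad :: "(real \<times> real \<Rightarrow> real \<times> real) \<Rightarrow> complex \<Rightarrow> complex" where
  "cgrad V z = cnj (cpx (V (pt z)))"

lemma inner_cgrad: "V (pt z) \<bullet> pt w = Re (cgrad V z * w)"
  using inner_pt[of "cpx (V (pt z))" w] by (simp add: cgrad_def)

text \<open>\<open>cpx\<close> and \<open>pt\<close> are mutually inverse linear maps, so the chain
  rule applies both ways. Working within an arbitrary \<open>S\<close> carries one-sided gradients
  at boundary points over to the complex plane.\<close>

lemma has_derivative_cgrad_iff: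
  "((\<Phi> \<circ> pt) has_derivative (\<lambda>v. Re (cgrad V (cpx p) * v))) (at (cpx p) within cpx ` S) \<longleftrightarrow>
   (\<Phi> has_derivative (\<lambda>v. V p \<bullet> v)) (at p within S)"
proof
  assume *: "((\<Phi> \<circ> pt) has_derivative (\<lambda>v. Re (cgrad V (cpx p) * v))) (at (cpx p) within cpx ` S)"
  have "(cpx has_derivative cpx) (at p within S)"
    using bounded_linear_cpx bounded_linear_imp_has_derivative by blast
  from diff_chain_within[OF this *]
  have "(\<Phi> has_derivative (\<lambda>v. Re (cgrad V (cpx p) * cpx v))) (at p within S)"
    by (simp add: o_def)
  then show "(\<Phi> has_derivative (\<lambda>v. V p \<bullet> v)) (at p within S)"
    using inner_cgrad[of V "cpx p" "cpx _"] by (simp del: Re_cpx times_complex.sel)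
next
  assume *: "(\<Phi> has_derivative (\<lambda>v. V p \<bullet> v)) (at p within S)"
  have "(pt has_derivative pt) (at (cpx p) within cpx ` S)"
    using bounded_linear_pt bounded_linear_imp_has_derivative by blast
  from diff_chain_within[OF this, of \<Phi> "(\<bullet>) (V p)"] *
  have "((\<Phi> \<circ> pt) has_derivative (\<lambda>v. V p \<bullet> pt v)) (at (cpx p) within cpx ` S)"
    by (simp only: pt_image_cpx pt_cpx o_def)
  then show "((\<Phi> \<circ> pt) has_derivative (\<lambda>v. Re (cgrad V (cpx p) * v))) (at (cpx p) within cpx ` S)"
    using inner_cgrad[of V "cpx p"] by (simp del: times_complex.sel)
qed

lemma continuous_on_cgrad_iff: "continuous_on (cpx ` S) (cgrad V) \<longleftrightarrow> continuous_on S V"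
proof
  assume *: "continuous_on (cpx ` S) (cgrad V)"
  have "continuous_on S (\<lambda>p. pt (cnj (cgrad V (cpx p))))"
    by (intro bounded_linear.continuous_on[OF bounded_linear_pt] continuous_intros
        continuous_on_compose2[OF *] bounded_linear.continuous_on[OF bounded_linear_cpx]) auto
  then show "continuous_on S V" by (simp add: cgrad_def)
next
  assume *: "continuous_on S V"
  show "continuous_on (cpx ` S) (cgrad V)"
    unfolding cgrad_def
    by (intro bounded_linear.continuous_on[OF bounded_linear_pt] continuous_intros
        continuous_on_compose2[OF *] bounded_linear.continuous_on[OF bounded_linear_cpx]) auto
qed

lemma Re_mult_functional_eqD: "(\<lambda>v. Re (a * v)) = (\<lambda>v. Re (b * v)) \<Longrightarrow> a = b"
  by (frule fun_cong[of _ _ 1], drule fun_cong[of _ _ \<i>])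
     (simp add: complex_eq_iff)

lemma Re_gradient_unique:
  assumes "(f has_derivative (\<lambda>v. Re (a * v))) (at z)" "(f has_derivative (\<lambda>v. Re (b * v))) (at z)"
  shows "a = b"
  using has_derivative_unique[OF assms] by (rule Re_mult_functional_eqD)

text \<open>For a gradient (a, b), symmetry of its derivative and vanishing of the trace are exactly
  the Cauchy-Riemann equations of a - \<i>b. Conversely, multiplication by a complex number followed
  by conjugation has trace 0, which is the Laplace equation.\<close>

lemma harmonic_on_iff_holomorphic:
  assumes U: "open U"
  shows "harmonic_on \<Phi> U \<longleftrightarrow>
    (\<exists>g. g holomorphic_on cpx ` U \<and> (\<forall>z\<in>cpx ` U. ((\<Phi> \<circ> pt) has_derivative (\<lambda>v. Re (g z * v))) (at z)))"
proof
  have oU: "open (cpx ` U)" using U by (rule open_cpx_image)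
  have aU: "at (cpx p) within cpx ` U = at (cpx p)" "at p within U = at p" if "p \<in> U" for p
    using that U oU by (auto intro: at_within_open)
  note gr = has_derivative_cgrad_iff[where S = U]
  assume "harmonic_on \<Phi> U"
  then obtain V D where VD: "\<forall>p\<in>U. GDERIV \<Phi> p :> V p \<and> (V has_derivative D p) (at p)"
    and tr: "\<And>p. p \<in> U \<Longrightarrow> (\<Sum>b\<in>Basis. D p b \<bullet> b) = 0"
    unfolding harmonic_on_def by blast
  have V: "(\<Phi> has_derivative (\<lambda>v. V p \<bullet> v)) (at p)" and D: "(V has_derivative D p) (at p)"
    if "p \<in> U" for p
    using VD that by (simp_all add: gderiv_def inner_commute[of "V p"])
  have "(cgrad V has_field_derivative cnj (cpx (D p (1,0)))) (at (cpx p))" if p: "p \<in> U" for p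
  proof -
    interpret D: bounded_linear "D p" using D[OF p] by (rule has_derivative_bounded_linear)
    have t: "snd (D p (0,1)) = - fst (D p (1,0))"
      using tr[OF p] by (simp add: Basis_prod_def sum.union_disjoint inner_prod_def)
    have s: "snd (D p (1,0)) = fst (D p (0,1))"
      using gradient_derivative_symmetric[OF U p V D[OF p], of "(1,0)" "(0,1)"] by (simp add: inner_prod_def)
    have lin: "D p v = fst v *\<^sub>R D p (1,0) + snd v *\<^sub>R D p (0,1)" for v
      using D.add[of "fst v *\<^sub>R (1,0)" "snd v *\<^sub>R (0,1)"]
      by (cases v) (simp add: flip: D.scaleR)
    have pt: "(pt has_derivative pt) (at (cpx p))"
      using bounded_linear_pt by (rule bounded_linear_imp_has_derivative)
    have cx: "(cpx has_derivative cpx) (at q)" for q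
      using bounded_linear_cpx by (rule bounded_linear_imp_has_derivative)
    have "((\<lambda>z. V (pt z)) has_derivative (\<lambda>v. D p (pt v))) (at (cpx p))"
      by (rule has_derivative_compose[OF pt]) (simp add: D[OF p])
    from has_derivative_cnj[OF has_derivative_compose[OF this cx]]
    have "(cgrad V has_derivative (\<lambda>v. cnj (cpx (D p (pt v))))) (at (cpx p))"
      unfolding cgrad_def .
    moreover have "(\<lambda>v. cnj (cpx (D p (pt v)))) = (*) (cnj (cpx (D p (1,0))))"
      by (rule ext, subst lin) (use s t in \<open>auto simp: complex_eq_iff algebra_simps\<close>)
    ultimately show ?thesis by (simp add: has_field_derivative_def)
  qed
  then have "cgrad V holomorphic_on cpx ` U"
    using oU by (auto simp: holomorphic_on_open)
  moreover have "\<forall>z\<in>cpx ` U. ((\<Phi> \<circ> pt) has_derivative (\<lambda>v. Re (cgrad V z * v))) (at z)"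
  proof (intro ballI, elim imageE)
    fix z p assume p: "p \<in> U" "z = cpx p"
    show "((\<Phi> \<circ> pt) has_derivative (\<lambda>v. Re (cgrad V z * v))) (at z)"
      using gr[of \<Phi> V p, unfolded aU[OF p(1)]] V[OF p(1)] unfolding p(2) by (rule iffD2)
  qed
  ultimately have "cgrad V holomorphic_on cpx ` U \<and>
      (\<forall>z\<in>cpx ` U. ((\<Phi> \<circ> pt) has_derivative (\<lambda>v. Re (cgrad V z * v))) (at z))"
    by (rule conjI)
  then show "\<exists>g. g holomorphic_on cpx ` U \<and>
      (\<forall>z\<in>cpx ` U. ((\<Phi> \<circ> pt) has_derivative (\<lambda>v. Re (g z * v))) (at z))"
    by (rule exI[of _ "cgrad V"])
next
  have oU: "open (cpx ` U)" using U by (rule open_cpx_image)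
  have aU: "at (cpx p) within cpx ` U = at (cpx p)" "at p within U = at p" if "p \<in> U" for p
    using that U oU by (auto intro: at_within_open)
  assume "\<exists>g. g holomorphic_on cpx ` U \<and>
      (\<forall>z\<in>cpx ` U. ((\<Phi> \<circ> pt) has_derivative (\<lambda>v. Re (g z * v))) (at z))"
  then obtain g where g: "g holomorphic_on cpx ` U"
    and gd: "\<forall>z\<in>cpx ` U. ((\<Phi> \<circ> pt) has_derivative (\<lambda>v. Re (g z * v))) (at z)"
    by (elim exE conjE)
  define V where "V p = pt (cnj (g (cpx p)))" for p
  define D where "D p v = pt (cnj (deriv g (cpx p) * cpx v))" for p v
  have Vg: "cgrad V = g" by (rule ext) (simp add: cgrad_def V_def)
  have pt: "(pt has_derivative pt) (at q)" for q
    using bounded_linear_pt by (rule bounded_linear_imp_has_derivative)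
  have cx: "(cpx has_derivative cpx) (at q)" for q
    using bounded_linear_cpx by (rule bounded_linear_imp_has_derivative)
  have "GDERIV \<Phi> p :> V p" if "p \<in> U" for p
    using gd[rule_format, of "cpx p"] has_derivative_cgrad_iff[of \<Phi> V p U] that
    by (simp add: aU Vg gderiv_def inner_commute[of "V p"] del: times_complex.sel)
  moreover have "(V has_derivative D p) (at p)" if p: "p \<in> U" for p
  proof -
    have "(g has_derivative (*) (deriv g (cpx p))) (at (cpx p))"
      using holomorphic_derivI[OF g oU] p by (auto simp: has_field_derivative_def)
    from has_derivative_compose[OF has_derivative_cnj[OF has_derivative_compose[OF cx this]] pt]
    show ?thesis unfolding V_def D_def .
  qed
  moreover have "continuous_on U (\<lambda>p. D p v)" for v
    unfolding D_def
    by (intro bounded_linear.continuous_on[OF bounded_linear_pt] continuous_intros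
        continuous_on_compose2[OF holomorphic_on_imp_continuous_on[OF holomorphic_deriv[OF g oU]]]
        bounded_linear.continuous_on[OF bounded_linear_cpx]) auto
  moreover have "(\<Sum>b\<in>Basis. D p b \<bullet> b) = 0" for p
    by (simp add: Basis_prod_def sum.union_disjoint D_def inner_prod_def)
  ultimately show "harmonic_on \<Phi> U"
    unfolding harmonic_on_def by (intro exI[of _ V] exI[of _ D]) simp
qed

text \<open>The pair encodes df = Re (g dz) up to the boundary. No primitive of g is demanded: where
  f has to be the real part of a holomorphic function, the primitive is obtained from the shape of
  the domain.\<close>

definition potential_on :: "complex set \<Rightarrow> (complex \<Rightarrow> real) \<Rightarrow> (complex \<Rightarrow> complex) \<Rightarrow> bool" where
  "potential_on U f g \<longleftrightarrow> continuous_on (closure U) g \<and> g holomorphic_on U \<and>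
     (\<forall>z\<in>closure U. (f has_derivative (\<lambda>v. Re (g z * v))) (at z within closure U))"

text \<open>\<open>harmonic_on\<close> only supplies some holomorphic gradient. At interior points
  gradients are unique, so it must be \<open>cgrad V\<close>, the one that extends continuously to
  the closure.\<close>

lemma potential_on_cpx_image:
  assumes U: "open U"
  shows "potential_on (cpx ` U) (\<Phi> \<circ> pt) (cgrad V) \<longleftrightarrow>
    has_gradient_on \<Phi> V (closure U) \<and> harmonic_on \<Phi> U"
proof -
  have oU: "open (cpx ` U)" using U by (rule open_cpx_image)
  have 1: "has_gradient_on \<Phi> V (closure U) \<longleftrightarrow> continuous_on (closure (cpx ` U)) (cgrad V) \<and>
     (\<forall>z\<in>closure (cpx ` U). ((\<Phi> \<circ> pt) has_derivative (\<lambda>v. Re (cgrad V z * v))) (at z within closure (cpx ` U)))"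
    unfolding has_gradient_on_def closure_cpx_image continuous_on_cgrad_iff
    by (simp add: has_derivative_cgrad_iff del: times_complex.sel)
  have at: "((\<Phi> \<circ> pt) has_derivative F) (at z)"
    if "((\<Phi> \<circ> pt) has_derivative F) (at z within closure (cpx ` U))" "z \<in> cpx ` U" for z F
    using has_derivative_subset[OF that(1) closure_subset] at_within_open[OF that(2) oU] by simp
  show ?thesis
  proof (cases "has_gradient_on \<Phi> V (closure U)")
    case True
    note gr = True[unfolded 1]
    have grU: "((\<Phi> \<circ> pt) has_derivative (\<lambda>v. Re (cgrad V z * v))) (at z)" if "z \<in> cpx ` U" for z
      using that gr closure_subset[of "cpx ` U"] by (intro at) (simp_all add: subset_iff del: times_complex.sel)
    have "harmonic_on \<Phi> U \<longleftrightarrow> cgrad V holomorphic_on cpx ` U"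
    proof
      assume "harmonic_on \<Phi> U"
      then obtain g where g: "g holomorphic_on cpx ` U"
        and gd: "\<forall>z\<in>cpx ` U. ((\<Phi> \<circ> pt) has_derivative (\<lambda>v. Re (g z * v))) (at z)"
        unfolding harmonic_on_iff_holomorphic[OF U] by (elim exE conjE)
      have "g z = cgrad V z" if "z \<in> cpx ` U" for z
        using Re_gradient_unique[OF gd[rule_format, OF that] grU[OF that]] .
      then show "cgrad V holomorphic_on cpx ` U"
        using holomorphic_transform[OF g] by simp
    next
      assume "cgrad V holomorphic_on cpx ` U"
      then show "harmonic_on \<Phi> U"
        unfolding harmonic_on_iff_holomorphic[OF U] using grU by (intro exI[of _ "cgrad V"] conjI ballI)
    qed
    then show ?thesis using True gr by (simp add: potential_on_def del: times_complex.sel)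
  next
    case False
    from this[unfolded 1] show ?thesis
      unfolding potential_on_def 1 by (auto simp del: times_complex.sel)
  qed
qed

section \<open>The exponential map on the region below a periodic graph\<close>

text \<open>Riemann's theorem asks for a bounded function, whereas only the real part of f is
  controlled. An upper bound for the real part near 0 is enough, because it confines the values to a
  half plane.\<close>

lemma removable_singularity_Re_tendsto_0:
  assumes r: "r > 0" and f: "f holomorphic_on ball 0 r - {0}" and Re0: "((\<lambda>z. Re (f z)) \<longlongrightarrow> 0) (at 0)"
  shows "\<exists>L. (f \<longlongrightarrow> L) (at 0) \<and> Re L = 0"
proof -
  have "\<forall>\<^sub>F z in at 0. Re (f z) < 1"
    using Re0 by (rule order_tendstoD) simp
  then obtain s where s: "s > 0" "\<And>z. z \<noteq> 0 \<Longrightarrow> norm z < s \<Longrightarrow> Re (f z) < 1"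
    by (auto simp: eventually_at dist_norm)
  define B where "B = ball (0::complex) (min r s)"
  have B: "open B" "0 \<in> B" "connected B" using r s by (auto simp: B_def)
  text \<open>The Moebius map \<open>w \<mapsto> w / (2 - w)\<close> sends the half plane \<open>Re w < 1\<close> to the unit disc.\<close>
  define m where "m z = f z / (2 - f z)" for z
  have Re1: "Re (f z) < 1" if "z \<in> B - {0}" for z using that s by (auto simp: B_def)
  then have ne: "2 - f z \<noteq> 0" if "z \<in> B - {0}" for z using that by force
  have m1: "norm (m z) < 1" if "z \<in> B - {0}" for z
  proof -
    have "(norm (f z))\<^sup>2 < (norm (2 - f z))\<^sup>2"
      using Re1[OF that] by (simp add: cmod_power2 power2_diff)
    then have "norm (f z) < norm (2 - f z)" by (rule power2_less_imp_less) simp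
    then show ?thesis using ne[OF that] by (simp add: m_def norm_divide)
  qed
  have "m holomorphic_on B - {0}"
    unfolding m_def using ne by (intro holomorphic_intros holomorphic_on_subset[OF f]) (auto simp: B_def)
  moreover have "0 \<in> interior B" using B by (simp add: interior_open)
  moreover have "\<forall>\<^sub>F z in at 0. norm (m z) \<le> 1"
    unfolding eventually_at_topological using B m1 by (intro exI[of _ B]) (auto intro: less_imp_le)
  ultimately obtain M where M: "M holomorphic_on B" "\<And>z. z \<in> B - {0} \<Longrightarrow> M z = m z"
    using holomorphic_on_extend_bounded[of m B 0] by blast
  \<comment> \<open>The value -1 is the image of \<infinity> under the Moebius map, so
    \<open>M 0 = -1\<close> would mean a pole of f. Then \<open>norm (M z)\<close> would be maximal
    at 0 and \<open>M\<close> constant; but no finite point is sent to -1.\<close>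
  have M0: "M 0 \<noteq> -1"
  proof
    assume a: "M 0 = -1"
    have "norm (M z) \<le> norm (M 0)" if "z \<in> B" for z
      using that M(2)[of z] m1[of z] by (cases "z = 0") (auto simp: a)
    then have "M constant_on B"
      using maximum_modulus_principle[OF M(1) B(1,3,1) order_refl B(2)] by blast
    moreover have z: "of_real (min r s / 2) \<in> B - {0}" (is "?z \<in> _") using r s by (auto simp: B_def)
    ultimately have "m ?z = -1"
      using M(2)[OF z] a B(2) z unfolding constant_on_def by auto
    then show False using ne[OF z] by (simp add: m_def field_simps)
  qed
  have "isCont M 0"
    using holomorphic_on_imp_continuous_on[OF M(1)] B continuous_on_eq_continuous_at by blast
  then have "(M \<longlongrightarrow> M 0) (at 0)" by (simp add: isCont_def)
  then have "((\<lambda>z. 2 * M z / (1 + M z)) \<longlongrightarrow> 2 * M 0 / (1 + M 0)) (at 0)"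
    using M0 by (intro tendsto_intros) (auto simp: add_eq_0_iff)
  moreover have "2 * M z / (1 + M z) = f z" if "z \<in> B" "z \<noteq> 0" for z
  proof -
    have k: "2 - f z \<noteq> 0" using ne that by blast
    have M_eq: "M z = f z / (2 - f z)" using that M(2)[of z] by (simp add: m_def)
    have "1 + M z = 2 / (2 - f z)"
      using k unfolding M_eq by (simp add: field_simps)
    then have "2 * M z / (1 + M z) = 2 * (f z / (2 - f z)) / (2 / (2 - f z))"
      unfolding M_eq by (rule arg_cong)
    also have "\<dots> = f z" using k by (simp add: divide_simps)
    finally show ?thesis .
  qed
  ultimately have lim: "(f \<longlongrightarrow> 2 * M 0 / (1 + M 0)) (at 0)"
    using B by (metis (no_types, lifting) Lim_transform_within_open)
  then have "((\<lambda>z. Re (f z)) \<longlongrightarrow> Re (2 * M 0 / (1 + M 0))) (at 0)" by (rule tendsto_Re)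
  with Re0 have "Re (2 * M 0 / (1 + M 0)) = 0" by (metis tendsto_unique at_neq_bot)
  with lim show ?thesis by blast
qed

lemma periodic_of_int:
  fixes f :: "'a::ring_1 \<Rightarrow> 'b"
  assumes "\<And>x. f (x + p) = f x"
  shows "f (x + of_int n * p) = f x"
proof -
  have nat: "f (x + of_nat k * p) = f x" for k x
    by (induction k) (simp_all add: algebra_simps flip: assms[of "x + of_nat _ * p"] add.assoc)
  show ?thesis
    using nat[of x "nat n"] nat[of "x + of_int n * p" "nat (- n)"]
    by (cases "n \<ge> 0") (simp_all add: algebra_simps)
qed

section \<open>The half-cylinder, its image under the exponential, and their closures\<close>

locale periodic_graph =
  fixes \<xi> :: "real \<Rightarrow> real"
  assumes continuous: "continuous_on UNIV \<xi>" and periodic: "\<xi> (\<theta> + 2 * pi) = \<xi> \<theta>"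
begin

definition E :: "complex set" where "E = {z. Re z < \<xi> (Im z)}"
text \<open>The point 0 stands for the end \<rho> = -\<infinity>, which the exponential does not
  reach. Adding it gives a starlike domain.\<close>

definition D :: "complex set" where "D = insert 0 (exp ` E)"

lemma exp_eq_imp_Im: "exp z = exp w \<Longrightarrow> \<xi> (Im z) = \<xi> (Im w)"
  using periodic_of_int[of \<xi> "2 * pi"] periodic
  by (force simp: exp_eq mult.commute mult.left_commute)

text \<open>\<open>exp z\<close> determines \<open>Re z\<close> and, by periodicity,
  \<open>\<xi> (Im z)\<close>, so the choice of logarithm does not matter. The relation
  \<open>P\<close> is kept general because \<open><\<close>, \<open>\<le>\<close>, \<open>=\<close>
  and \<open>>\<close> describe the domain, its closure, its frontier and its exterior.\<close>

lemma exp_mem_exp_image: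
  fixes P :: "real \<Rightarrow> real \<Rightarrow> bool" and z :: complex
  shows "exp z \<in> exp ` {z. P (Re z) (\<xi> (Im z))} \<longleftrightarrow> P (Re z) (\<xi> (Im z))"
proof
  assume "exp z \<in> exp ` {z. P (Re z) (\<xi> (Im z))}"
  then obtain w where "exp z = exp w" "P (Re w) (\<xi> (Im w))" by auto
  moreover then have "Re z = Re w" by (metis exp_eq_polar norm_exp_eq_Re exp_inj_iff)
  ultimately show "P (Re z) (\<xi> (Im z))" using exp_eq_imp_Im by metis
qed auto

lemma continuous_Im: "continuous_on UNIV (\<lambda>z. \<xi> (Im z))"
  by (rule continuous_on_compose2[OF continuous]) (auto intro: continuous_intros)

lemma open_E: "open E"
  unfolding E_def by (intro open_Collect_less continuous_Im continuous_intros)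

lemma closure_E: "closure E = {z. Re z \<le> \<xi> (Im z)}"
proof
  show "closure E \<subseteq> {z. Re z \<le> \<xi> (Im z)}"
    by (rule closure_minimal) (auto simp: E_def intro!: closed_Collect_le continuous_Im continuous_intros)
next
  show "{z. Re z \<le> \<xi> (Im z)} \<subseteq> closure E"
  proof
    fix z assume z: "z \<in> {z. Re z \<le> \<xi> (Im z)}"
    have "(\<lambda>n. z - of_real (inverse (real (Suc n)))) \<longlonglongrightarrow> z - of_real 0"
      by (intro tendsto_intros LIMSEQ_inverse_real_of_nat)
    moreover have "z - of_real (inverse (real (Suc n))) \<in> E" for n
      using z by (auto simp: E_def intro: less_le_trans[of _ "Re z"])
    ultimately show "z \<in> closure E"
      unfolding closure_sequential by (intro exI[of _ "\<lambda>n. z - of_real (inverse (real (Suc n)))"]) auto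
  qed
qed

lemma bounded_range: "bounded (range \<xi>)"
proof -
  have "range \<xi> \<subseteq> \<xi> ` {-pi..pi}"
  proof safe
    fix \<theta>
    \<comment> \<open>\<open>Ln (exp (Complex 0 \<theta>))\<close> reduces \<theta> modulo 2\<pi> to
      the interval from -\<pi> to \<pi>.\<close>
    have "\<xi> \<theta> = \<xi> (Im (Ln (exp (Complex 0 \<theta>))))"
      using exp_eq_imp_Im[of "Complex 0 \<theta>" "Ln (exp (Complex 0 \<theta>))"] by simp
    moreover have "Im (Ln (exp (Complex 0 \<theta>))) \<in> {-pi..pi}"
      using Im_Ln_le_pi[of "exp (Complex 0 \<theta>)"] mpi_less_Im_Ln[of "exp (Complex 0 \<theta>)"] by simp
    ultimately show "\<xi> \<theta> \<in> \<xi> ` {-pi..pi}" by blast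
  qed
  moreover have "bounded (\<xi> ` {-pi..pi})"
    by (intro compact_imp_bounded compact_continuous_image continuous_on_subset[OF continuous]) auto
  ultimately show ?thesis by (rule bounded_subset[rotated])
qed

lemma open_exp_image: "open (exp ` S :: complex set)" if "open S" for S
proof (rule open_mapping_thm[of exp UNIV])
  have "exp (0::complex) \<noteq> exp 1" by (simp add: exp_eq_1)
  then show "\<not> exp constant_on (UNIV :: complex set)"
    unfolding constant_on_def by (metis UNIV_I)
qed (use that in \<open>auto intro: holomorphic_intros\<close>)

lemma open_D: "open D"
proof -
  obtain b where b: "\<And>\<theta>. \<bar>\<xi> \<theta>\<bar> \<le> b" using bounded_range by (auto simp: bounded_iff)
  have "z \<in> D" if "z \<in> ball 0 (exp (- b))" for z
  proof (cases "z = 0")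
    case False
    have "ln (norm z) < ln (exp (- b))" using that False by (subst ln_less_cancel_iff) auto
    then have "ln (norm z) < - b" by simp
    then have "Ln z \<in> E"
      using b[of "Im (Ln z)"] False by (simp add: E_def)
    then show ?thesis using False by (metis D_def exp_Ln imageI insertI2)
  qed (simp add: D_def)
  then have "ball 0 (exp (- b)) \<subseteq> D" by blast
  moreover have "0 \<in> ball (0::complex) (exp (- b))" by simp
  ultimately have "D = ball 0 (exp (- b)) \<union> exp ` E" unfolding D_def by blast
  then show ?thesis using open_exp_image[OF open_E] by auto
qed

text \<open>The exponential is an open map, so the region above the graph has an open image. That
  image is the complement of the right-hand side, which is therefore closed.\<close>

lemma closure_D: "closure D = insert 0 (exp ` closure E)"
proof
  have "- insert 0 (exp ` closure E) = exp ` {z. Re z > \<xi> (Im z)}" (is "?L = ?R")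
  proof -
    have "z \<in> ?L \<longleftrightarrow> z \<in> ?R" for z
    proof (cases "z = 0")
      case False
      then obtain w where "z = exp w" by (metis exp_Ln)
      then show ?thesis
        using exp_mem_exp_image[where P = "\<lambda>x y. x > y"] exp_mem_exp_image[where P = "\<lambda>x y. x \<le> y"]
        by (auto simp: closure_E not_le)
    qed auto
    then show ?thesis by blast
  qed
  moreover have "open {z. Re z > \<xi> (Im z)}"
    by (intro open_Collect_less continuous_Im continuous_intros)
  ultimately have "closed (insert 0 (exp ` closure E))"
    unfolding closed_def using open_exp_image by metis
  then show "closure D \<subseteq> insert 0 (exp ` closure E)"
    using closure_subset[of E] by (intro closure_minimal) (auto simp: D_def)
  have "exp ` closure E \<subseteq> closure (exp ` E)"
    using closure_subset[of "exp ` E"] by (intro image_closure_subset continuous_intros) auto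
  also have "\<dots> \<subseteq> closure D" by (intro closure_mono) (auto simp: D_def)
  finally show "insert 0 (exp ` closure E) \<subseteq> closure D"
    using closure_subset[of D] by (auto simp: D_def)
qed

lemma exp_mem_D [simp]: "exp z \<in> D \<longleftrightarrow> Re z < \<xi> (Im z)"
  using exp_mem_exp_image[where P = "\<lambda>x y. x < y"] by (auto simp: D_def E_def)

lemma exp_mem_closure_D [simp]: "exp z \<in> closure D \<longleftrightarrow> Re z \<le> \<xi> (Im z)"
  using exp_mem_exp_image[where P = "\<lambda>x y. x \<le> y"] by (auto simp: closure_D closure_E)

lemma frontier_D: "frontier D = exp ` {z. Re z = \<xi> (Im z)}"
proof -
  have "z \<in> frontier D \<longleftrightarrow> z \<in> exp ` {z. Re z = \<xi> (Im z)}" for z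
  proof (cases "z = 0")
    case True
    then show ?thesis using open_D by (auto simp: frontier_def interior_open D_def)
  next
    case False
    then obtain w where "z = exp w" by (metis exp_Ln)
    then show ?thesis
      using exp_mem_exp_image[where P = "\<lambda>x y. x = y"] open_D by (auto simp: frontier_def interior_open)
  qed
  then show ?thesis by blast
qed

lemma compact_closure_D: "compact (closure D)"
proof -
  obtain b where b: "\<And>\<theta>. \<bar>\<xi> \<theta>\<bar> \<le> b" using bounded_range by (auto simp: bounded_iff)
  have "norm z \<le> exp b" if "z \<in> D" for z
  proof (cases "z = 0")
    case False
    then have "z \<in> exp ` E" using that by (simp add: D_def)
    then obtain u where "z = exp u" "Re u < \<xi> (Im u)" by (auto simp: E_def)
    then show ?thesis using b[of "Im u"] by simp
  qed simp
  then have "bounded D" by (auto simp: bounded_iff)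
  then show ?thesis by (simp add: compact_closure)
qed

text \<open>Shrinking by a factor t in (0, 1] is a shift by \<open>ln t \<le> 0\<close> in the
  logarithmic variable, and \<open>E\<close> is invariant under shifts to the left. Starlikeness
  later provides primitives of holomorphic functions on \<open>D\<close>.\<close>

lemma segment_D: "closed_segment 0 z \<subseteq> D" if "z \<in> D"
proof
  fix w assume "w \<in> closed_segment 0 z"
  then obtain t where t: "0 \<le> t" "t \<le> 1" "w = of_real t * z"
    by (auto simp: in_segment scaleR_conv_of_real)
  show "w \<in> D"
  proof (cases "w = 0")
    case False
    then have "z \<in> exp ` E" using that t by (auto simp: D_def)
    then obtain u where u: "z = exp u" "Re u < \<xi> (Im u)"
      by (auto simp: E_def)
    have "w = exp (of_real (ln t) + u)"
      using t False u by (simp add: exp_add exp_of_real flip: of_real_exp)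
    moreover have "ln t \<le> 0" using t False by simp
    ultimately show ?thesis using u by simp
  qed (simp add: D_def)
qed

lemma starlike_D: "starlike D"
  unfolding starlike_def using segment_D by (intro bexI[of _ 0]) (auto simp: D_def)

end

section \<open>Transfer of potentials between the half-cylinder and the disc\<close>

lemma Re_gradient_constant:
  assumes U: "open U" "connected U"
    and f1: "\<And>z. z \<in> U \<Longrightarrow> (f1 has_derivative (\<lambda>v. Re (g z * v))) (at z)"
    and f2: "\<And>z. z \<in> U \<Longrightarrow> (f2 has_derivative (\<lambda>v. Re (g z * v))) (at z)"
  shows "\<exists>c. \<forall>z\<in>U. f1 z = f2 z + c"
proof -
  have "((\<lambda>z. f1 z - f2 z) has_derivative (\<lambda>v. 0)) (at z within U)" if "z \<in> U" for z
    by (rule has_derivative_at_withinI) (rule has_derivative_diff[OF f1[OF that] f2[OF that], unfolded diff_self])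
  moreover from this have "continuous_on U (\<lambda>z. f1 z - f2 z)"
    by (rule has_derivative_continuous_on)
  ultimately have "(\<lambda>z. f1 z - f2 z) constant_on U"
    using has_derivative_zero_connected_constant_on[OF U(2,1) finite.emptyI, of "\<lambda>z. f1 z - f2 z"]
    unfolding Diff_empty by blast
  then obtain c where "\<And>z. z \<in> U \<Longrightarrow> f1 z - f2 z = c" unfolding constant_on_def by blast
  then show ?thesis by (intro exI[of _ c]) (simp add: diff_eq_eq add.commute)
qed

lemma has_derivative_Re_primitive:
  assumes "(\<Gamma> has_field_derivative d) (at z)"
  shows "((\<lambda>z. Re (\<Gamma> z)) has_derivative (\<lambda>v. Re (d * v))) (at z)"
  using has_derivative_Re[OF assms[unfolded has_field_derivative_def]] .

lemma potential_onD:
  assumes "potential_on U f g"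
  shows "continuous_on (closure U) g" "g holomorphic_on U"
    "\<And>z. z \<in> closure U \<Longrightarrow> (f has_derivative (\<lambda>v. Re (g z * v))) (at z within closure U)"
  using assms unfolding potential_on_def by auto

lemma potential_on_has_derivative_at:
  assumes "potential_on U f g" "open U" "z \<in> U"
  shows "(f has_derivative (\<lambda>v. Re (g z * v))) (at z)"
proof -
  have "(f has_derivative (\<lambda>v. Re (g z * v))) (at z within closure U)"
    using potential_onD(3)[OF assms(1)] assms(3) closure_subset by blast
  then have "(f has_derivative (\<lambda>v. Re (g z * v))) (at z within U)"
    by (rule has_derivative_subset) (rule closure_subset)
  then show ?thesis using at_within_open[OF assms(3,2)] by simp
qed

lemma potential_on_diff:
  assumes "potential_on U f1 g1" "potential_on U f2 g2"
  shows "potential_on U (\<lambda>z. f1 z - f2 z) (\<lambda>z. g1 z - g2 z)"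
  using potential_onD[OF assms(1)] potential_onD[OF assms(2)] unfolding potential_on_def
  by (auto intro!: continuous_intros holomorphic_intros derivative_eq_intros simp: algebra_simps)

lemma potential_on_minus:
  assumes "potential_on U f g"
  shows "potential_on U (\<lambda>z. - f z) (\<lambda>z. - g z)"
  using potential_onD[OF assms] unfolding potential_on_def
  by (auto intro!: continuous_intros holomorphic_intros derivative_eq_intros simp: algebra_simps)

lemma potential_on_continuous: "potential_on U f g \<Longrightarrow> continuous_on (closure U) f"
  by (auto simp: potential_on_def intro: has_derivative_continuous_on)

text \<open>The principal logarithm jumps on the negative real axis. Dividing by \<open>w\<close>
  first moves the cut away from \<open>w\<close>, and adding \<open>z\<close> prescribes the
  branch.\<close>

lemma local_inverse_exp:
  assumes "w \<noteq> 0" "exp z = w"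
  obtains N L where "open N" "w \<in> N" "0 \<notin> N" "L w = z" "L holomorphic_on N" "\<And>x. x \<in> N \<Longrightarrow> exp (L x) = x"
    "(L has_field_derivative inverse w) (at w)"
proof -
  define N where "N = (\<lambda>x. x / w) -` (- \<real>\<^sub>\<le>\<^sub>0)"
  define L where "L x = Ln (x / w) + z" for x
  have "open N"
    unfolding N_def using assms
    by (intro open_vimage open_Compl closed_nonpos_Reals_complex continuous_intros) auto
  moreover have "w \<in> N" "0 \<notin> N" "L w = z" using assms by (auto simp: N_def L_def)
  moreover have "L holomorphic_on N"
    unfolding L_def using assms by (auto simp: N_def intro!: holomorphic_intros)
  moreover have "exp (L x) = x" if "x \<in> N" for x
  proof -
    have "x \<noteq> 0" using that by (auto simp: N_def)
    then show ?thesis using assms by (simp add: L_def exp_add)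
  qed
  moreover have "(L has_field_derivative inverse w) (at w)"
    unfolding L_def using assms by (auto intro!: derivative_eq_intros simp: field_simps)
  ultimately show ?thesis by (rule that)
qed

context periodic_graph
begin

text \<open>With w = exp z, the form g dw becomes g (exp z) exp z dz. The chain rule is taken
  relative to the closures, so boundary points are included.\<close>

lemma potential_on_D_imp_E:
  assumes "potential_on D f g"
  shows "potential_on E (f \<circ> exp) (\<lambda>z. g (exp z) * exp z)"
  unfolding potential_on_def
proof (intro conjI ballI)
  note fg = potential_onD[OF assms]
  have sub: "exp ` closure E \<subseteq> closure D" by (auto simp: closure_E)
  show "continuous_on (closure E) (\<lambda>z. g (exp z) * exp z)"
    using sub by (intro continuous_intros continuous_on_compose2[OF fg(1)]) auto
  have "(g \<circ> exp) holomorphic_on E"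
    by (rule holomorphic_on_compose_gen[OF _ fg(2)]) (auto simp: E_def intro: holomorphic_intros)
  then show "(\<lambda>z. g (exp z) * exp z) holomorphic_on E"
    by (auto intro!: holomorphic_intros simp: o_def)
  fix z assume z: "z \<in> closure E"
  have "(f has_derivative (\<lambda>v. Re (g (exp z) * v))) (at (exp z) within exp ` closure E)"
    using z sub by (intro has_derivative_subset[OF fg(3) sub]) auto
  moreover have "(exp has_derivative (*) (exp z)) (at z within closure E)"
    using DERIV_exp[of z] by (auto simp: has_field_derivative_def intro: has_derivative_at_withinI)
  ultimately show "(f \<circ> exp has_derivative (\<lambda>v. Re (g (exp z) * exp z * v))) (at z within closure E)"
    using diff_chain_within[of exp "(*) (exp z)" z "closure E" f "\<lambda>v. Re (g (exp z) * v)"]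
    by (simp add: o_def mult.assoc del: times_complex.sel)
qed

text \<open>Inside \<open>E\<close> a translate of F has the translated gradient, and gradients are
  unique. At boundary points the identity follows from the continuity of G.\<close>

lemma potential_on_E_periodic:
  assumes FG: "potential_on E F G" and per: "\<And>z. F (z + 2 * pi * \<i>) = F z" and z: "z \<in> closure E"
  shows "G (z + 2 * pi * \<i>) = G z"
proof -
  have mem: "z + 2 * pi * \<i> \<in> E" if "z \<in> E" for z using that by (simp add: E_def periodic)
  have cmem: "z + 2 * pi * \<i> \<in> closure E" if "z \<in> closure E" for z
    using that by (simp add: closure_E periodic)
  have "G (z + 2 * pi * \<i>) - G z = 0" if "z \<in> E" for z
  proof -
    have "((\<lambda>z. F (z + 2 * pi * \<i>)) has_derivative (\<lambda>v. Re (G (z + 2 * pi * \<i>) * v))) (at z)"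
      by (rule has_derivative_compose[where g = F and f = "\<lambda>z. z + 2 * pi * \<i>" and f' = "\<lambda>v. v",
            OF _ potential_on_has_derivative_at[OF FG open_E mem[OF that]]])
         (auto intro!: derivative_eq_intros)
    then show ?thesis
      using Re_gradient_unique[OF _ potential_on_has_derivative_at[OF FG open_E that]] per by simp
  qed
  moreover have "continuous_on (closure E) (\<lambda>z. G (z + 2 * pi * \<i>) - G z)"
    using cmem by (intro continuous_intros continuous_on_compose2[OF potential_onD(1)[OF FG]]
        potential_onD(1)[OF FG]) auto
  ultimately have "G (z + 2 * pi * \<i>) - G z = 0"
    using continuous_constant_on_closure[of E "\<lambda>z. G (z + 2 * pi * \<i>) - G z" 0 z] z by blast
  then show ?thesis by simp
qed

text \<open>The maximum principle is drawn from the maximum modulus principle: on the starlike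
  domain a potential is Re \<Gamma> + c, so \<open>norm (exp (\<Gamma> w))\<close> is largest where
  the potential is. It is applied to the difference of the potentials and to its negative; gradients
  then agree inside, and by continuity on the closure.\<close>

lemma potential_on_D_unique:
  assumes 1: "potential_on D f1 g1" and 2: "potential_on D f2 g2"
    and bd: "\<And>\<theta>. f1 (exp (Complex (\<xi> \<theta>) \<theta>)) = f2 (exp (Complex (\<xi> \<theta>) \<theta>))"
    and z: "z \<in> closure D"
  shows "g1 z = g2 z"
proof -
  have le: "f w \<le> 0" if fg: "potential_on D f g" and bd: "\<And>w. w \<in> frontier D \<Longrightarrow> f w = 0"
    and w: "w \<in> closure D" for f g w
  proof -
    have "0 \<in> D" by (simp add: D_def)
    then have "closure D \<noteq> {}" using closure_subset by blast
    then obtain z0 where z0: "z0 \<in> closure D" "\<And>w. w \<in> closure D \<Longrightarrow> f w \<le> f z0"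
      using continuous_attains_sup[OF compact_closure_D _ potential_on_continuous[OF fg]] by blast
    show ?thesis
    proof (cases "z0 \<in> D")
      case False
      then have "f z0 = 0" using z0 open_D by (intro bd) (simp add: frontier_def interior_open)
      then show ?thesis using z0(2)[OF w] by simp
    next
      case True
      note g = potential_onD(2)[OF fg]
      obtain \<Gamma> where \<Gamma>: "\<And>w. w \<in> D \<Longrightarrow> (\<Gamma> has_field_derivative g w) (at w)"
        using holomorphic_starlike_primitive[OF holomorphic_on_imp_continuous_on[OF g] starlike_D open_D
            finite.emptyI] holomorphic_on_imp_differentiable_at[OF g open_D] by auto
      obtain c where c: "\<And>w. w \<in> D \<Longrightarrow> f w = Re (\<Gamma> w) + c"
        using Re_gradient_constant[OF open_D starlike_imp_connected[OF starlike_D],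
            of f g "\<lambda>w. Re (\<Gamma> w)"] potential_on_has_derivative_at[OF fg open_D]
          has_derivative_Re_primitive[OF \<Gamma>] by auto
      have "(\<lambda>w. exp (\<Gamma> w)) constant_on D"
      proof (rule maximum_modulus_principle[OF _ open_D starlike_imp_connected[OF starlike_D] open_D order_refl True])
        have "\<Gamma> holomorphic_on D" using \<Gamma> open_D by (auto simp: holomorphic_on_open)
        then show "(\<lambda>w. exp (\<Gamma> w)) holomorphic_on D" by (intro holomorphic_intros)
        show "norm (exp (\<Gamma> w)) \<le> norm (exp (\<Gamma> z0))" if "w \<in> D" for w
          using z0(2)[of w] that closure_subset c[OF that] c[OF True] by auto
      qed
      then obtain k where k: "\<And>w. w \<in> D \<Longrightarrow> exp (\<Gamma> w) = k" unfolding constant_on_def by blast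
      \<comment> \<open>An interior maximum makes f constant in \<open>D\<close>. Continuity extends
        this to the closure, where a single boundary value shows that the constant is 0.\<close>
      have "f w = ln (norm k) + c" if "w \<in> D" for w
        using c[OF that] k[OF that] by (metis ln_exp norm_exp_eq_Re)
      then have const: "f w = ln (norm k) + c" if "w \<in> closure D" for w
        using continuous_constant_on_closure[OF potential_on_continuous[OF fg] _ that] by blast
      have fr: "exp (Complex (\<xi> 0) 0) \<in> frontier D" by (auto simp: frontier_D)
      then have "exp (Complex (\<xi> 0) 0) \<in> closure D" by (simp add: frontier_def)
      then show ?thesis using const[OF w] const bd[OF fr] by simp
    qed
  qed
  have bd': "f1 w - f2 w = 0" if w: "w \<in> frontier D" for w
  proof -
    obtain u where "w = exp u" "Re u = \<xi> (Im u)" using w unfolding frontier_D by blast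
    then have "w = exp (Complex (\<xi> (Im u)) (Im u))" by (metis complex_surj)
    then show ?thesis using bd by simp
  qed
  have P: "potential_on D (\<lambda>z. f1 z - f2 z) (\<lambda>z. g1 z - g2 z)"
    by (rule potential_on_diff[OF 1 2])
  have eq: "f1 w - f2 w = 0" if "w \<in> closure D" for w
    using le[OF P bd' that] le[OF potential_on_minus[OF P] _ that] bd' by auto
  have "g1 w - g2 w = 0" if "w \<in> D" for w
  proof -
    have "((\<lambda>z. f1 z - f2 z) has_derivative (\<lambda>v. Re (0 * v))) (at w)"
      by (rule has_derivative_transform_within_open[where f = "\<lambda>_. 0", OF _ open_D that])
         (use eq closure_subset[of D] in auto)
    then show ?thesis
      using Re_gradient_unique[OF potential_on_has_derivative_at[OF P open_D that]] by blast
  qed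
  then have "g1 z - g2 z = 0"
    using continuous_constant_on_closure[OF potential_onD(1)[OF P] _ z] by blast
  then show ?thesis by simp
qed

text \<open>F depends on exp z only, and the chain rule forces the new gradient at w = exp z to be G
  divided by w. Away from 0, local branches of the logarithm give the regularity. At 0, the
  assumption \<open>lim\<close> and the periodicity of F together show that G tends to 0, and only
  then does the quotient extend holomorphically.\<close>

lemma potential_on_E_imp_D:
  assumes FG: "potential_on E F G" and per: "\<And>z. F (z + 2 * pi * \<i>) = F z"
    and lim: "\<And>\<epsilon>. \<epsilon> > 0 \<Longrightarrow> \<exists>\<rho>. \<forall>z\<in>E. Re z < \<rho> \<longrightarrow> \<bar>Re (G z)\<bar> < \<epsilon>"
  shows "\<exists>f g. potential_on D f g \<and>
    (\<forall>z\<in>closure E. f (exp z) = F z \<and> g (exp z) * exp z = G z)"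
proof -
  note FGD = potential_onD[OF FG]
  have F_eq: "F z = F z'" if "exp z = exp z'" for z z'
    using that periodic_of_int[of F "2 * pi * \<i>"] per by (auto simp: exp_eq mult.commute mult.left_commute)
  have G_eq: "G z = G z'" if eq: "exp z = exp z'" and z: "z \<in> closure E" for z z'
  proof -
    \<comment> \<open>Extension by 0 outside the closure: iterating a period requires a function
      that is periodic everywhere, and the closure of \<open>E\<close> is invariant under the
      translation.\<close>
    define H where "H z = (if z \<in> closure E then G z else 0)" for z
    have "H (z + 2 * pi * \<i>) = H z" for z
      using potential_on_E_periodic[OF FG per] by (auto simp: H_def closure_E periodic)
    from periodic_of_int[of H, OF this] eq have "H z = H z'"
      by (auto simp: exp_eq mult.commute mult.left_commute)
    moreover have "z' \<in> closure E"
      using z eq exp_mem_closure_D[of z] exp_mem_closure_D[of z'] by (simp add: closure_E)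
    ultimately show ?thesis using z by (simp add: H_def)
  qed
  have mem: "z \<in> closure E" if "exp z = w" "w \<in> closure D" for z w
    using that by (auto simp: closure_E)
  have memE: "z \<in> E" if "exp z = w" "w \<in> D" for z w
    using that by (auto simp: E_def)
  \<comment> \<open>\<open>p\<close> is w times the gradient to be constructed. By
    \<open>G_eq\<close> its values do not depend on the branch, so near the cut of \<open>Ln\<close>
    a local branch may replace it.\<close>
  define p where "p w = G (Ln w)" for w
  have p_cont: "continuous (at w within closure D) p" if w: "w \<in> closure D" "w \<noteq> 0" for w
  proof -
    obtain N L where NL: "open N" "w \<in> N" "0 \<notin> N" "L w = Ln w" "L holomorphic_on N"
      "\<And>x. x \<in> N \<Longrightarrow> exp (L x) = x"
      using local_inverse_exp[OF w(2) exp_Ln[OF w(2)]] by metis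
    have "continuous_on (closure D \<inter> N) (\<lambda>x. G (L x))"
      by (rule continuous_on_compose2[OF FGD(1) continuous_on_subset[OF holomorphic_on_imp_continuous_on[OF NL(5)]]])
         (use mem[OF NL(6)] in auto)
    moreover have "G (L x) = p x" if "x \<in> closure D \<inter> N" for x
    proof -
      have "x \<noteq> 0" "exp (L x) = x" "L x \<in> closure E" using NL(3,6) that mem[OF NL(6)] by auto
      then show ?thesis unfolding p_def by (intro G_eq) auto
    qed
    ultimately have "continuous_on (closure D \<inter> N) p"
      by (rule continuous_on_eq)
    then have "continuous (at w within closure D \<inter> N) p"
      using w NL(2) by (simp add: continuous_on_eq_continuous_within)
    moreover have "at w within closure D \<inter> N = at w within closure D"
      by (rule at_within_nhd[OF NL(2,1)]) auto
    ultimately show ?thesis by simp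
  qed
  have p_hol: "p holomorphic_on D - {0}"
  proof -
    have "p field_differentiable at w" if w: "w \<in> D - {0}" for w
    proof -
      obtain N L where NL: "open N" "w \<in> N" "0 \<notin> N" "L w = Ln w" "L holomorphic_on N"
        "\<And>x. x \<in> N \<Longrightarrow> exp (L x) = x"
        using local_inverse_exp[of w "Ln w"] exp_Ln[of w] w by (metis DiffD2 singletonI)
      have "(G \<circ> L) holomorphic_on D \<inter> N"
        by (rule holomorphic_on_compose_gen[OF holomorphic_on_subset[OF NL(5)] FGD(2)])
           (use memE[OF NL(6)] in auto)
      moreover have "(G \<circ> L) x = p x" if "x \<in> D \<inter> N" for x
      proof -
        have "x \<noteq> 0" "exp (L x) = x" "L x \<in> closure E"
          using NL(3,6) that mem[OF NL(6)] closure_subset[of D] by auto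
        then show ?thesis unfolding p_def o_def by (intro G_eq) auto
      qed
      ultimately have "p holomorphic_on D \<inter> N"
        by (rule holomorphic_transform)
      then show ?thesis
        using w NL open_D by (intro holomorphic_on_imp_differentiable_at[of _ "D \<inter> N"]) auto
    qed
    then show ?thesis
      by (auto simp: holomorphic_on_def field_differentiable_at_within)
  qed
  have f_deriv: "((\<lambda>w. F (Ln w)) has_derivative (\<lambda>v. Re (p w / w * v))) (at w within closure D)"
    if w: "w \<in> closure D" "w \<noteq> 0" for w
  proof -
    obtain N L where NL: "open N" "w \<in> N" "0 \<notin> N" "L w = Ln w"
      "\<And>x. x \<in> N \<Longrightarrow> exp (L x) = x" and L': "(L has_field_derivative inverse w) (at w)"
      using local_inverse_exp[OF w(2) exp_Ln[OF w(2)]] by metis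
    have "(L has_derivative (*) (inverse w)) (at w within closure D \<inter> N)"
      using L' by (auto simp: has_field_derivative_def intro: has_derivative_at_withinI)
    moreover have "(F has_derivative (\<lambda>v. Re (G (L w) * v))) (at (L w) within L ` (closure D \<inter> N))"
      using mem[OF NL(5)] NL(2) w by (intro has_derivative_subset[OF FGD(3)]) auto
    ultimately have "(F \<circ> L has_derivative (\<lambda>v. Re (G (L w) * v)) \<circ> (*) (inverse w)) (at w within closure D \<inter> N)"
      by (rule diff_chain_within)
    moreover have "(\<lambda>v. Re (G (L w) * v)) \<circ> (*) (inverse w) = (\<lambda>v. Re (p w / w * v))"
      by (simp add: o_def NL(4) p_def divide_inverse mult.assoc)
    moreover have "at w within closure D \<inter> N = at w within closure D"
      by (rule at_within_nhd[OF NL(2,1)]) auto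
    ultimately have *: "(F \<circ> L has_derivative (\<lambda>v. Re (p w / w * v))) (at w within closure D)" by simp
    obtain d where d: "d > 0" "ball w d \<subseteq> N" using NL(1,2) openE by blast
    have "(F \<circ> L) x = F (Ln x)" if "dist x w < d" for x
    proof -
      have "x \<in> N" using d that by (auto simp: dist_commute)
      then have "x \<noteq> 0" "exp (L x) = x" using NL(3,5) by auto
      then show ?thesis unfolding o_def by (intro F_eq) auto
    qed
    then show ?thesis by (intro has_derivative_transform_within[OF * d(1) w(1)])
  qed
  obtain r where r: "r > 0" "ball 0 r \<subseteq> D"
    using open_D openE[of D 0] by (auto simp: D_def)
  have Re_p: "((\<lambda>w. Re (p w)) \<longlongrightarrow> 0) (at 0)"
  proof (rule tendstoI)
    fix \<epsilon> :: real assume "\<epsilon> > 0"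
    then obtain \<rho> where \<rho>: "\<And>z. z \<in> E \<Longrightarrow> Re z < \<rho> \<Longrightarrow> \<bar>Re (G z)\<bar> < \<epsilon>" using lim by blast
    \<comment> \<open>\<open>norm w < exp \<rho>\<close> says that the logarithm lies to the left of
      \<rho>, so decay at the end of the half-cylinder is decay at the puncture.\<close>
    have "dist (Re (p w)) 0 < \<epsilon>" if "w \<noteq> 0" "dist w 0 < min r (exp \<rho>)" for w
    proof -
      have "ln (norm w) < ln (exp \<rho>)" using that by (subst ln_less_cancel_iff) auto
      moreover have "w \<in> D" using that r by (auto simp: dist_norm)
      ultimately show ?thesis
        using that \<rho>[of "Ln w"] memE[of "Ln w" w] by (simp add: p_def)
    qed
    then show "\<forall>\<^sub>F w in at 0. dist (Re (p w)) 0 < \<epsilon>"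
      unfolding eventually_at using r by (intro exI[of _ "min r (exp \<rho>)"]) auto
  qed
  have "p holomorphic_on ball 0 r - {0}" using r by (intro holomorphic_on_subset[OF p_hol]) auto
  from removable_singularity_Re_tendsto_0[OF r(1) this Re_p]
  obtain l where l: "(p \<longlongrightarrow> l) (at 0)" "Re l = 0" by blast
  text \<open>By Rolle's theorem for the periodic function \<open>F (Complex \<rho> \<theta>)\<close> of \<open>\<theta>\<close>, the imaginary part
    of \<open>G\<close> has a zero on each vertical line in \<open>E\<close>.\<close>
  have Rolle: "\<exists>\<theta>. Im (G (Complex \<rho> \<theta>)) = 0" if \<rho>: "\<And>\<theta>. \<rho> < \<xi> \<theta>" for \<rho>
  proof -
    have d: "((\<lambda>\<theta>. F (Complex \<rho> \<theta>)) has_derivative (\<lambda>v. Re (G (Complex \<rho> \<theta>) * (of_real v * \<i>)))) (at \<theta>)" for \<theta>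
    proof (rule has_derivative_compose[where g = F and f = "Complex \<rho>" and f' = "\<lambda>v. of_real v * \<i>"
          and g' = "\<lambda>v. Re (G (Complex \<rho> \<theta>) * v)"])
      have "((\<lambda>\<theta>. of_real \<rho> + of_real \<theta> * \<i>) has_derivative (\<lambda>v. of_real v * \<i>)) (at \<theta>)"
        by (auto intro!: derivative_eq_intros)
      moreover have "Complex \<rho> = (\<lambda>\<theta>. of_real \<rho> + of_real \<theta> * \<i>)"
        by (auto simp: fun_eq_iff complex_eq_iff)
      ultimately show "(Complex \<rho> has_derivative (\<lambda>v. of_real v * \<i>)) (at \<theta>)" by simp
      show "(F has_derivative (\<lambda>v. Re (G (Complex \<rho> \<theta>) * v))) (at (Complex \<rho> \<theta>))"
        using \<rho> by (intro potential_on_has_derivative_at[OF FG open_E]) (simp add: E_def)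
    qed
    have "F (Complex \<rho> 0) = F (Complex \<rho> (2 * pi))"
      using per[of "Complex \<rho> 0"] by (simp add: Complex_eq mult.commute)
    moreover have "continuous_on {0..2 * pi} (\<lambda>\<theta>. F (Complex \<rho> \<theta>))"
      using d by (meson has_derivative_at_withinI has_derivative_continuous_on)
    ultimately obtain \<theta> where "(\<lambda>v. Re (G (Complex \<rho> \<theta>) * (of_real v * \<i>))) = (\<lambda>v. 0)"
      using Rolle_deriv[of 0 "2 * pi" "\<lambda>\<theta>. F (Complex \<rho> \<theta>)" "\<lambda>\<theta> v. Re (G (Complex \<rho> \<theta>) * (of_real v * \<i>))"] d
      by auto
    from fun_cong[OF this, of 1] show ?thesis by auto
  qed
  have "Im l = 0"
  proof -
    obtain b where b: "\<And>\<theta>. \<bar>\<xi> \<theta>\<bar> \<le> b" using bounded_range by (auto simp: bounded_iff)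
    \<comment> \<open>The lines at abscissa \<open>- b - 1 - real n\<close> lie wholly below the
      graph and move to the left, so their images shrink to 0. Each carries a zero of the imaginary
      part of G, which forces \<open>Im l = 0\<close>.\<close>
    have "- b - 1 - real n < \<xi> \<theta>" for n \<theta> using b[of \<theta>] by simp
    then have "\<exists>\<theta>. Im (G (Complex (- b - 1 - real n) \<theta>)) = 0" for n by (rule Rolle)
    then obtain \<theta> where \<theta>: "\<And>n. Im (G (Complex (- b - 1 - real n) (\<theta> n))) = 0" by metis
    define w where "w n = exp (Complex (- b - 1 - real n) (\<theta> n))" for n
    have "Complex (- b - 1 - real n) (\<theta> n) \<in> closure E" for n
      using b[of "\<theta> n"] by (simp add: closure_E)
    then have Im_p: "Im (p (w n)) = 0" for n
      using G_eq[of "Complex (- b - 1 - real n) (\<theta> n)" "Ln (w n)"] \<theta>[of n] by (simp add: w_def p_def)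
    have "(\<lambda>n. exp (- b - 1 - real n)) \<longlonglongrightarrow> 0" by real_asymp
    then have "w \<longlonglongrightarrow> 0"
      by (subst tendsto_norm_zero_iff[symmetric]) (simp add: w_def)
    moreover have "w n \<noteq> 0" for n by (simp add: w_def)
    ultimately have "filterlim w (at 0) sequentially" by (simp add: filterlim_at)
    from tendsto_Im[OF filterlim_compose[OF l(1) this]] show ?thesis
      by (simp add: Im_p LIMSEQ_const_iff)
  qed
  with l(2) have "l = 0" by (simp add: complex_eq_iff)
  with l(1) have p0: "(p \<longlongrightarrow> 0) (at 0)" by simp
  define P where "P w = (if w = 0 then 0 else p w)" for w
  have "P holomorphic_on D"
  proof -
    have "((\<lambda>w. (w - 0) * p w) \<longlongrightarrow> 0) (at 0)"
      using tendsto_mult[OF tendsto_ident_at p0] by simp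
    moreover have "0 \<in> interior D" using open_D by (simp add: interior_open D_def)
    ultimately obtain Q where Q: "Q holomorphic_on D" "\<And>w. w \<in> D - {0} \<Longrightarrow> Q w = p w"
      using holomorphic_on_extend_lim[OF p_hol] by blast
    have "isCont Q 0"
      using holomorphic_on_imp_continuous_on[OF Q(1)] open_D continuous_on_eq_continuous_at
      by (metis D_def insertI1)
    then have "(Q \<longlongrightarrow> Q 0) (at 0)" by (simp add: isCont_def)
    moreover have "(Q \<longlongrightarrow> 0) (at 0)"
      by (rule Lim_transform_within_open[OF p0 open_D]) (use Q(2) in \<open>auto simp: D_def\<close>)
    ultimately have "Q 0 = 0" using tendsto_unique[OF at_neq_bot] by blast
    then show ?thesis
      using Q by (intro holomorphic_transform[OF Q(1)]) (auto simp: P_def)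
  qed
  define g where "g w = (if w = 0 then deriv P 0 else p w / w)" for w
  have g_hol: "g holomorphic_on D"
    by (rule pole_theorem_open_0[OF \<open>P holomorphic_on D\<close> open_D, of 0]) (auto simp: P_def g_def)
  \<comment> \<open>F has no value over the puncture, so the value of the new potential at 0 is
    taken from a primitive of \<open>g\<close>: near 0 the two differ by a constant, because a
    punctured disc is connected.\<close>
  obtain \<Gamma> where \<Gamma>: "\<And>w. w \<in> D \<Longrightarrow> (\<Gamma> has_field_derivative g w) (at w)"
    using holomorphic_starlike_primitive[OF holomorphic_on_imp_continuous_on[OF g_hol] starlike_D open_D
        finite.emptyI] holomorphic_on_imp_differentiable_at[OF g_hol open_D] by auto
  have "((\<lambda>w. F (Ln w)) has_derivative (\<lambda>v. Re (g w * v))) (at w)" if "w \<in> ball 0 r - {0}" for w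
  proof -
    have "w \<in> D" using that r by auto
    moreover then have "w \<in> closure D" using closure_subset by blast
    ultimately show ?thesis
      using has_derivative_subset[OF f_deriv closure_subset, of w] that at_within_open[OF _ open_D, of w]
      by (simp add: g_def del: times_complex.sel)
  qed
  moreover have "connected (ball (0::complex) r - {0})"
    by (intro connected_punctured_ball) simp
  ultimately obtain c where c: "\<And>w. w \<in> ball 0 r - {0} \<Longrightarrow> F (Ln w) = Re (\<Gamma> w) + c"
    using Re_gradient_constant[of "ball 0 r - {0}" "\<lambda>w. F (Ln w)" g "\<lambda>w. Re (\<Gamma> w)"] r
      has_derivative_Re_primitive[OF \<Gamma>] by blast
  define f where "f w = (if w = 0 then Re (\<Gamma> 0) + c else F (Ln w))" for w
  have "potential_on D f g"
    unfolding potential_on_def continuous_on_eq_continuous_within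
  proof (intro conjI ballI g_hol)
    fix w assume w: "w \<in> closure D"
    show "continuous (at w within closure D) g"
    proof (cases "w = 0")
      case True
      then have "isCont g w"
        using holomorphic_on_imp_continuous_on[OF g_hol] open_D continuous_on_eq_continuous_at
        by (metis D_def insertI1)
      then show ?thesis by (rule continuous_at_imp_continuous_at_within)
    next
      case False
      have "continuous (at w within closure D) (\<lambda>w. p w / w)"
        by (intro continuous_intros p_cont w False)
      then show ?thesis
        by (rule continuous_transform_within[OF _ _ w, of _ "norm w"])
           (use False in \<open>auto simp: g_def\<close>)
    qed
    show "(f has_derivative (\<lambda>v. Re (g w * v))) (at w within closure D)"
    proof (cases "w = 0")
      case True
      have "((\<lambda>w. Re (\<Gamma> w) + c) has_derivative (\<lambda>v. Re (g w * v))) (at w)"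
        using has_derivative_add[OF has_derivative_Re_primitive[OF \<Gamma>, of w] has_derivative_const[of c]] True
        by (simp add: D_def del: times_complex.sel)
      then have "(f has_derivative (\<lambda>v. Re (g w * v))) (at w)"
        by (rule has_derivative_transform_within_open[where s = "ball 0 r"])
           (use r c True in \<open>auto simp: f_def\<close>)
      then show ?thesis by (rule has_derivative_at_withinI)
    next
      case False
      have "((\<lambda>w. F (Ln w)) has_derivative (\<lambda>v. Re (g w * v))) (at w within closure D)"
        using f_deriv[OF w False] False by (simp add: g_def del: times_complex.sel)
      then show ?thesis
        by (rule has_derivative_transform_within[where d = "norm w"])
           (use False w in \<open>auto simp: f_def\<close>)
    qed
  qed
  moreover have "f (exp z) = F z" "g (exp z) * exp z = G z" if "z \<in> closure E" for z
    using F_eq[of z "Ln (exp z)"] G_eq[of z "Ln (exp z)", OF _ that] by (auto simp: f_def g_def p_def)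
  ultimately show ?thesis by blast
qed

end

section \<open>Calculus on the circle and the outer normal\<close>

text \<open>Secants from the two sides of \<theta> have opposite limiting directions, so only the
  absolute value has a limit. For the question whether the limit is 0 nothing is lost.\<close>

lemma abs_inner_sgn_secant_tendsto:
  fixes c :: "real \<Rightarrow> 'a::real_inner"
  assumes c: "(c has_vector_derivative T) (at \<theta>)" and T: "T \<noteq> 0"
  shows "((\<lambda>\<tau>. \<bar>N \<bullet> sgn (c \<tau> - c \<theta>)\<bar>) \<longlongrightarrow> \<bar>N \<bullet> sgn T\<bar>) (at \<theta>)"
proof -
  have "((\<lambda>\<tau>. (c \<tau> - c \<theta>) /\<^sub>R (\<tau> - \<theta>)) \<longlongrightarrow> T) (at \<theta>)"
  proof (rule Lim_null[THEN iffD2], rule tendsto_norm_zero_cancel)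
    have "((\<lambda>\<tau>. norm (c \<tau> - c \<theta> - (\<tau> - \<theta>) *\<^sub>R T) / norm (\<tau> - \<theta>)) \<longlongrightarrow> 0) (at \<theta>)"
      using c by (simp add: has_vector_derivative_def has_derivative_iff_norm)
    moreover have "\<forall>\<^sub>F \<tau> in at \<theta>. norm (c \<tau> - c \<theta> - (\<tau> - \<theta>) *\<^sub>R T) / norm (\<tau> - \<theta>)
        = norm ((c \<tau> - c \<theta>) /\<^sub>R (\<tau> - \<theta>) - T)"
    proof -
      have "norm (c \<tau> - c \<theta> - (\<tau> - \<theta>) *\<^sub>R T) / norm (\<tau> - \<theta>) = norm ((c \<tau> - c \<theta>) /\<^sub>R (\<tau> - \<theta>) - T)"
        if "\<tau> \<noteq> \<theta>" for \<tau>
      proof -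
        have "(c \<tau> - c \<theta>) /\<^sub>R (\<tau> - \<theta>) - T = (c \<tau> - c \<theta> - (\<tau> - \<theta>) *\<^sub>R T) /\<^sub>R (\<tau> - \<theta>)"
          using that by (simp add: scaleR_diff_right)
        then show ?thesis by (simp add: divide_inverse mult.commute)
      qed
      then show ?thesis by (auto simp: eventually_at_filter)
    qed
    ultimately show "((\<lambda>\<tau>. norm ((c \<tau> - c \<theta>) /\<^sub>R (\<tau> - \<theta>) - T)) \<longlongrightarrow> 0) (at \<theta>)"
      by (rule Lim_transform_eventually)
  qed
  then have "((\<lambda>\<tau>. \<bar>N \<bullet> sgn ((c \<tau> - c \<theta>) /\<^sub>R (\<tau> - \<theta>))\<bar>) \<longlongrightarrow> \<bar>N \<bullet> sgn T\<bar>) (at \<theta>)"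
    using T by (intro tendsto_intros)
  moreover have "\<forall>\<^sub>F \<tau> in at \<theta>. \<bar>N \<bullet> sgn ((c \<tau> - c \<theta>) /\<^sub>R (\<tau> - \<theta>))\<bar> = \<bar>N \<bullet> sgn (c \<tau> - c \<theta>)\<bar>"
    by (auto simp: eventually_at_filter sgn_scaleR abs_mult sgn_if)
  ultimately show ?thesis by (rule Lim_transform_eventually)
qed

text \<open>\<open>outer_normal\<close> speaks of limits within the frontier as a set, without a
  parametrization. A local inverse \<open>\<kappa>\<close> of the curve on \<open>F\<close> turns
  limits in the parameter into such limits; composing with \<open>c\<close> goes back.\<close>

lemma inner_sgn_secant_tendsto_0_iff:
  fixes c :: "real \<Rightarrow> 'a::real_inner"
  assumes c: "(c has_vector_derivative T) (at \<theta>)" and T: "T \<noteq> 0"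
    and F: "\<And>\<tau>. c \<tau> \<in> F" and \<kappa>: "filterlim \<kappa> (at \<theta>) (at (c \<theta>) within F)"
    and c\<kappa>: "\<forall>\<^sub>F q in at (c \<theta>) within F. c (\<kappa> q) = q"
  shows "((\<lambda>q. N \<bullet> sgn (q - c \<theta>)) \<longlongrightarrow> 0) (at (c \<theta>) within F) \<longleftrightarrow> N \<bullet> T = 0"
proof -
  note lim = abs_inner_sgn_secant_tendsto[OF c T, of N]
  have sgn0: "N \<bullet> T = 0 \<longleftrightarrow> N \<bullet> sgn T = 0" using T by (simp add: sgn_div_norm)
  show ?thesis
  proof
    assume "N \<bullet> T = 0"
    with lim have "((\<lambda>\<tau>. N \<bullet> sgn (c \<tau> - c \<theta>)) \<longlongrightarrow> 0) (at \<theta>)"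
      using sgn0 by (simp add: tendsto_rabs_zero_iff)
    from filterlim_compose[OF this \<kappa>]
    show "((\<lambda>q. N \<bullet> sgn (q - c \<theta>)) \<longlongrightarrow> 0) (at (c \<theta>) within F)"
      by (rule Lim_transform_eventually) (use c\<kappa> in \<open>auto elim: eventually_mono\<close>)
  next
    assume *: "((\<lambda>q. N \<bullet> sgn (q - c \<theta>)) \<longlongrightarrow> 0) (at (c \<theta>) within F)"
    \<comment> \<open>Tested against \<open>T\<close> itself, the absolute values tend to
      \<open>norm T\<close>, which is positive; so the secants do not vanish near \<theta>.\<close>
    have "\<forall>\<^sub>F \<tau> in at \<theta>. c \<tau> \<noteq> c \<theta>"
    proof -
      have "\<forall>\<^sub>F \<tau> in at \<theta>. \<bar>T \<bullet> sgn (c \<tau> - c \<theta>)\<bar> > 0"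
        using abs_inner_sgn_secant_tendsto[OF c T, of T] T
        by (intro order_tendstoD(1)) (auto simp: sgn_div_norm)
      then show ?thesis by (rule eventually_mono) auto
    qed
    moreover have "(c \<longlongrightarrow> c \<theta>) (at \<theta>)"
      using has_vector_derivative_continuous[OF c] by (simp add: continuous_within)
    ultimately have "filterlim c (at (c \<theta>) within F) (at \<theta>)"
      using F by (simp add: filterlim_at)
    from tendsto_rabs_zero[OF filterlim_compose[OF * this]] lim have "\<bar>N \<bullet> sgn T\<bar> = 0"
      by (metis tendsto_unique at_neq_bot)
    then show "N \<bullet> T = 0" using sgn0 by simp
  qed
qed

abbreviation (input) circ :: "real \<Rightarrow> real \<times> real" where "circ \<theta> \<equiv> (cos \<theta>, sin \<theta>)"

lemma cpx_circ: "cpx (circ \<theta>) = cis \<theta>"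
  by (simp add: cpx_def cis.ctr)

lemma sphere_eq_range_circ: "sphere 0 1 = range circ"
proof -
  have "\<exists>\<theta>. x = circ \<theta>" if "norm x = 1" for x :: "real \<times> real"
    using that sincos_total_2pi[of "fst x" "snd x"]
    by (metis norm_prod_def prod.collapse real_norm_def real_sqrt_eq_1_iff power2_abs)
  then have "x \<in> range circ" if "x \<in> sphere 0 1" for x :: "real \<times> real"
    using that unfolding mem_sphere_0 by blast
  then have "sphere 0 1 \<subseteq> range circ" by (rule subsetI)
  moreover have "range circ \<subseteq> sphere 0 1" by (auto simp: norm_prod_def)
  ultimately show ?thesis by (rule equalityI)
qed

text \<open>Only the derivative along the parametrization is known. A branch of the logarithm gives
  the angle near the given point as a differentiable function on the plane, and composing with it
  yields the derivative within the circle.\<close>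

lemma has_derivative_on_circle:
  assumes u: "((\<lambda>\<theta>. k (circ \<theta>)) has_real_derivative u') (at \<theta>)"
  shows "(k has_derivative (\<lambda>v. (u' *\<^sub>R (- sin \<theta>, cos \<theta>)) \<bullet> v)) (at (circ \<theta>) within sphere 0 1)"
proof -
  obtain N L where NL: "open N" "cis \<theta> \<in> N" "L (cis \<theta>) = \<i> * \<theta>" "\<And>x. x \<in> N \<Longrightarrow> exp (L x) = x"
      and L': "(L has_field_derivative inverse (cis \<theta>)) (at (cis \<theta>))"
    using local_inverse_exp[of "cis \<theta>" "\<i> * \<theta>"] by (metis cis_conv_exp cis_neq_zero)
  have d1: "(cpx has_derivative cpx) (at (circ \<theta>) within sphere 0 1)"
    using bounded_linear_cpx by (rule bounded_linear_imp_has_derivative)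
  have d2: "((\<lambda>p. L (cpx p)) has_derivative (\<lambda>v. inverse (cis \<theta>) * cpx v)) (at (circ \<theta>) within sphere 0 1)"
    using L' by (intro has_derivative_compose[OF d1]) (simp add: has_field_derivative_def cpx_circ)
  have "((\<lambda>p. k (circ (Im (L (cpx p))))) has_derivative (\<lambda>v. u' * Im (inverse (cis \<theta>) * cpx v)))
      (at (circ \<theta>) within sphere 0 1)"
    using u by (intro has_derivative_compose[where g = "\<lambda>\<theta>. k (circ \<theta>)", OF has_derivative_Im[OF d2]])
      (simp add: has_field_derivative_def cpx_circ NL(3))
  moreover have "(\<lambda>v. u' * Im (inverse (cis \<theta>) * cpx v)) = (\<lambda>v. (u' *\<^sub>R (- sin \<theta>, cos \<theta>)) \<bullet> v)"
    by (auto simp: cis_inverse algebra_simps fun_eq_iff)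
  ultimately have *: "((\<lambda>p. k (circ (Im (L (cpx p))))) has_derivative (\<lambda>v. (u' *\<^sub>R (- sin \<theta>, cos \<theta>)) \<bullet> v))
      (at (circ \<theta>) within sphere 0 1)" by metis
  obtain d where d: "d > 0" "ball (cis \<theta>) d \<subseteq> N" using NL(1,2) openE by blast
  have "k (circ (Im (L (cpx p)))) = k p" if p: "p \<in> sphere 0 1" "dist p (circ \<theta>) < d" for p
  proof -
    have "norm (cpx p - cis \<theta>) = norm (p - circ \<theta>)"
      by (simp add: cmod_def norm_prod_def)
    then have "cpx p \<in> N" using p d by (auto simp: dist_norm norm_minus_commute)
    then have e: "exp (L (cpx p)) = cpx p" using NL by blast
    then have "norm (exp (L (cpx p))) = 1" using p by simp
    then have "Re (L (cpx p)) = 0" by simp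
    then have "cpx p = cis (Im (L (cpx p)))" using e by (simp add: exp_eq_polar)
    then have "cpx p = cpx (circ (Im (L (cpx p))))" by (simp add: cpx_circ)
    then have "p = circ (Im (L (cpx p)))" using inj_cpx by (simp only: inj_eq)
    then show ?thesis by simp
  qed
  then show ?thesis
    by (intro has_derivative_transform_within[OF * d(1)]) (simp_all add: norm_prod_def)
qed

text \<open>The derivative within the circle fixes only the tangential component of a representing
  vector; orthogonality to the radius fixes the other one, which makes the definite description
  unique.\<close>

lemma circle_grad_circ:
  assumes u: "((\<lambda>\<theta>. k (circ \<theta>)) has_real_derivative u') (at \<theta>)"
  shows "circle_grad k (circ \<theta>) = u' *\<^sub>R (- sin \<theta>, cos \<theta>)"
  unfolding circle_grad_def
proof (rule the_equality)
  show "(u' *\<^sub>R (- sin \<theta>, cos \<theta>)) \<bullet> circ \<theta> = 0 \<and>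
      (k has_derivative (\<lambda>v. (u' *\<^sub>R (- sin \<theta>, cos \<theta>)) \<bullet> v)) (at (circ \<theta>) within sphere 0 1)"
    using has_derivative_on_circle[OF u] by (simp add: algebra_simps)
next
  fix g assume g: "g \<bullet> circ \<theta> = 0 \<and> (k has_derivative (\<lambda>v. g \<bullet> v)) (at (circ \<theta>) within sphere 0 1)"
  have "(circ has_derivative (\<lambda>t. t *\<^sub>R (- sin \<theta>, cos \<theta>))) (at \<theta>)"
    by (auto intro!: derivative_eq_intros)
  moreover have "(k has_derivative (\<lambda>v. g \<bullet> v)) (at (circ \<theta>) within range circ)"
    using g by (simp add: sphere_eq_range_circ)
  ultimately have "((\<lambda>\<theta>. k (circ \<theta>)) has_derivative (\<lambda>t. g \<bullet> (t *\<^sub>R (- sin \<theta>, cos \<theta>)))) (at \<theta>)"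
    using diff_chain_within[of circ "\<lambda>t. t *\<^sub>R (- sin \<theta>, cos \<theta>)" \<theta> UNIV k "\<lambda>v. g \<bullet> v"]
    by (simp add: o_def)
  from has_derivative_unique[OF this u[unfolded has_field_derivative_def]]
  have t: "g \<bullet> (- sin \<theta>, cos \<theta>) = u'" by (metis mult.right_neutral scaleR_one)
  obtain a b where ab: "g = (a, b)" by (cases g)
  have e: "a * cos \<theta> + b * sin \<theta> = 0" "b * cos \<theta> - a * sin \<theta> = u'"
    using g t by (auto simp: ab)
  have "a * ((cos \<theta>)\<^sup>2 + (sin \<theta>)\<^sup>2) = (a * cos \<theta> + b * sin \<theta>) * cos \<theta> - (b * cos \<theta> - a * sin \<theta>) * sin \<theta>"
    "b * ((cos \<theta>)\<^sup>2 + (sin \<theta>)\<^sup>2) = (a * cos \<theta> + b * sin \<theta>) * sin \<theta> + (b * cos \<theta> - a * sin \<theta>) * cos \<theta>"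
    by algebra+
  then show "g = u' *\<^sub>R (- sin \<theta>, cos \<theta>)" unfolding e ab by simp
qed

text \<open>In complex notation the boundary is c = exp (\<xi> + \<i>\<theta>), with derivatives c
  (\<xi>' + \<i>) and c ((\<xi>' + \<i>)^2 + \<xi>''). The cross product is therefore exp (2\<xi>)
  (1 + \<xi>'^2 - \<xi>''), and the term with \<xi>'' is recognized from the derivative of \<xi>' /
  sqrt (1 + \<xi>'^2), which is \<xi>'' / (1 + \<xi>'^2)^(3/2).\<close>

lemma curvature_at_circ:
  assumes f: "\<And>\<theta>. 1 + h (circ \<theta>) = exp (\<xi> \<theta>)"
    and d1: "\<And>\<theta>. (\<xi> has_real_derivative \<xi>1 \<theta>) (at \<theta>)"
    and d2: "(\<xi>1 has_real_derivative \<xi>2) (at \<theta>)"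
  shows "curvature_at h (circ \<theta>) = exp (- \<xi> \<theta>) * (1 / sqrt (1 + (\<xi>1 \<theta>)\<^sup>2)
    - deriv (\<lambda>\<theta>. \<xi>1 \<theta> / sqrt (1 + (\<xi>1 \<theta>)\<^sup>2)) \<theta>)"
proof -
  define K where "K = 1 + (\<xi>1 \<theta>)\<^sup>2"
  have K: "K > 0" by (simp add: K_def add_pos_nonneg)
  define c where "c s = exp (\<xi> (\<theta> + s)) *\<^sub>R circ (\<theta> + s)" for s
  define c1 where "c1 s = exp (\<xi> (\<theta> + s)) *\<^sub>R
      (\<xi>1 (\<theta> + s) * cos (\<theta> + s) - sin (\<theta> + s), \<xi>1 (\<theta> + s) * sin (\<theta> + s) + cos (\<theta> + s))" for s
  define c2 where "c2 = exp (\<xi> \<theta>) *\<^sub>R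
      (((\<xi>1 \<theta>)\<^sup>2 + \<xi>2 - 1) * cos \<theta> - 2 * \<xi>1 \<theta> * sin \<theta>, ((\<xi>1 \<theta>)\<^sup>2 + \<xi>2 - 1) * sin \<theta> + 2 * \<xi>1 \<theta> * cos \<theta>)"
  have bd: "(\<lambda>s. bdry h (cos s *\<^sub>R circ \<theta> + sin s *\<^sub>R (- snd (circ \<theta>), fst (circ \<theta>)))) = c"
  proof
    fix s
    have "cos s *\<^sub>R circ \<theta> + sin s *\<^sub>R (- snd (circ \<theta>), fst (circ \<theta>)) = circ (\<theta> + s)"
      by (simp add: cos_add sin_add algebra_simps)
    then show "bdry h (cos s *\<^sub>R circ \<theta> + sin s *\<^sub>R (- snd (circ \<theta>), fst (circ \<theta>))) = c s"
      by (simp only: bdry_def c_def f)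
  qed
  have d1': "((\<lambda>s. \<xi> (\<theta> + s)) has_real_derivative \<xi>1 (\<theta> + s)) (at s)" for s
    using d1[of "\<theta> + s"] DERIV_shift[of \<xi> "\<xi>1 (\<theta> + s)" s \<theta>] by (simp add: add.commute)
  have d2': "((\<lambda>s. \<xi>1 (\<theta> + s)) has_real_derivative \<xi>2) (at 0)"
    using d2 DERIV_shift[of \<xi>1 \<xi>2 0 \<theta>] by (simp add: add.commute)
  have "(c has_vector_derivative c1 s) (at s)" for s
  proof -
    have "((\<lambda>s. exp (\<xi> (\<theta> + s)) * cos (\<theta> + s)) has_real_derivative fst (c1 s)) (at s)"
      "((\<lambda>s. exp (\<xi> (\<theta> + s)) * sin (\<theta> + s)) has_real_derivative snd (c1 s)) (at s)"
      by (rule derivative_eq_intros d1' refl | simp add: c1_def right_diff_distrib distrib_left)+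
    then show ?thesis
      using has_vector_derivative_Pair[of "\<lambda>s. exp (\<xi> (\<theta> + s)) * cos (\<theta> + s)" "fst (c1 s)" s UNIV
          "\<lambda>s. exp (\<xi> (\<theta> + s)) * sin (\<theta> + s)" "snd (c1 s)"]
      unfolding c_def by (simp add: has_real_derivative_iff_has_vector_derivative)
  qed
  then have c1: "(\<lambda>s. vector_derivative c (at s)) = c1"
    by (auto intro: vector_derivative_at)
  have "(c1 has_vector_derivative c2) (at 0)"
  proof -
    have "((\<lambda>s. fst (c1 s)) has_real_derivative fst c2) (at 0)"
      "((\<lambda>s. snd (c1 s)) has_real_derivative snd c2) (at 0)"
      unfolding c1_def c2_def fst_conv snd_conv fst_scaleR snd_scaleR real_scaleR_def
      by (rule derivative_eq_intros d1' d2' refl | simp add: algebra_simps power2_eq_square)+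
    then show ?thesis
      using has_vector_derivative_Pair[of "\<lambda>s. fst (c1 s)" "fst c2" 0 UNIV "\<lambda>s. snd (c1 s)" "snd c2"]
      by (simp add: has_real_derivative_iff_has_vector_derivative)
  qed
  then have c2: "vector_derivative c1 (at 0) = c2" by (rule vector_derivative_at)
  have cross: "fst (c1 0) * snd c2 - snd (c1 0) * fst c2 = (exp (\<xi> \<theta>))\<^sup>2 * (K - \<xi>2)"
  proof -
    have "fst (c1 0) * snd c2 - snd (c1 0) * fst c2
        = (exp (\<xi> \<theta>))\<^sup>2 * ((1 + (\<xi>1 \<theta>)\<^sup>2 - \<xi>2) * ((sin \<theta>)\<^sup>2 + (cos \<theta>)\<^sup>2))"
      unfolding c1_def c2_def fst_scaleR snd_scaleR fst_conv snd_conv real_scaleR_def add_0_right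
      by algebra
    then show ?thesis by (simp add: K_def)
  qed
  have nrm: "norm (c1 0) = exp (\<xi> \<theta>) * sqrt K"
  proof -
    have "(\<xi>1 \<theta> * cos \<theta> - sin \<theta>)\<^sup>2 + (\<xi>1 \<theta> * sin \<theta> + cos \<theta>)\<^sup>2 = K * ((sin \<theta>)\<^sup>2 + (cos \<theta>)\<^sup>2)"
      unfolding K_def by algebra
    then have nrm': "(\<xi>1 \<theta> * cos \<theta> - sin \<theta>)\<^sup>2 + (\<xi>1 \<theta> * sin \<theta> + cos \<theta>)\<^sup>2 = K" by simp
    have "norm (c1 0) = exp (\<xi> \<theta>) * norm (\<xi>1 \<theta> * cos \<theta> - sin \<theta>, \<xi>1 \<theta> * sin \<theta> + cos \<theta>)"
      by (simp only: c1_def norm_scaleR add_0_right abs_exp_cancel)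
    then show ?thesis by (simp only: norm_prod_def fst_conv snd_conv real_norm_def power2_abs nrm')
  qed
  have "((\<lambda>\<theta>. \<xi>1 \<theta> / sqrt (1 + (\<xi>1 \<theta>)\<^sup>2)) has_real_derivative
      (\<xi>2 * sqrt K - \<xi>1 \<theta> * (2 * \<xi>1 \<theta> * \<xi>2 * (inverse (sqrt K) / 2))) / (sqrt K * sqrt K)) (at \<theta>)"
    using K unfolding K_def
    by (auto intro!: derivative_eq_intros d2 simp: algebra_simps)
  then have "deriv (\<lambda>\<theta>. \<xi>1 \<theta> / sqrt (1 + (\<xi>1 \<theta>)\<^sup>2)) \<theta>
      = (\<xi>2 * sqrt K - \<xi>1 \<theta> * (2 * \<xi>1 \<theta> * \<xi>2 * (inverse (sqrt K) / 2))) / (sqrt K * sqrt K)"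
    by (rule DERIV_imp_deriv)
  also have "\<dots> = (\<xi>2 * (sqrt K * sqrt K) - (\<xi>1 \<theta>)\<^sup>2 * \<xi>2) / sqrt K ^ 3"
    using K by (simp add: field_simps power2_eq_square power3_eq_cube del: real_sqrt_mult_self)
  also have "\<dots> = \<xi>2 / sqrt K ^ 3"
    using K by (simp add: K_def algebra_simps)
  finally have dv: "deriv (\<lambda>\<theta>. \<xi>1 \<theta> / sqrt (1 + (\<xi>1 \<theta>)\<^sup>2)) \<theta> = \<xi>2 / sqrt K ^ 3" .
  have "curvature_at h (circ \<theta>) = (exp (\<xi> \<theta>))\<^sup>2 * (K - \<xi>2) / (exp (\<xi> \<theta>) * sqrt K) ^ 3"
    unfolding curvature_at_def bd plane_curvature_def Let_def c1 c2 cross nrm ..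
  also have "\<dots> = exp (- \<xi> \<theta>) * ((K - \<xi>2) / sqrt K ^ 3)"
  proof -
    have "e\<^sup>2 * a / (e * q) ^ 3 = inverse e * (a / q ^ 3)" if "e \<noteq> 0" for a e q :: real
      using that by (simp add: field_simps power2_eq_square power3_eq_cube)
    then show ?thesis by (simp only: exp_minus exp_not_eq_zero not_False_eq_True)
  qed
  also have "(K - \<xi>2) / sqrt K ^ 3 = 1 / sqrt K - \<xi>2 / sqrt K ^ 3"
  proof -
    have "K / sqrt K ^ 3 = 1 / sqrt K"
      using K by (simp add: power3_eq_cube)
    then show ?thesis by (simp add: diff_divide_distrib)
  qed
  finally show ?thesis by (simp add: dv K_def)
qed

section \<open>Boundary curve and outward normal of the star-shaped domain\<close>

locale circle_domain =
  fixes h :: "real \<times> real \<Rightarrow> real" and \<xi> \<xi>' :: "real \<Rightarrow> real"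
  assumes exp_\<xi>: "1 + h (circ \<theta>) = exp (\<xi> \<theta>)"
    and deriv_\<xi>: "(\<xi> has_real_derivative \<xi>' \<theta>) (at \<theta>)"
begin

sublocale periodic_graph \<xi>
proof
  show "continuous_on UNIV \<xi>"
    using deriv_\<xi> by (intro DERIV_continuous_on[where D = \<xi>']) (auto intro: has_field_derivative_at_within)
  show "\<xi> (\<theta> + 2 * pi) = \<xi> \<theta>" for \<theta>
    using exp_\<xi>[of \<theta>] exp_\<xi>[of "\<theta> + 2 * pi"] by simp
qed

definition c :: "real \<Rightarrow> complex" where "c \<theta> = exp (Complex (\<xi> \<theta>) \<theta>)"

lemma c_eq: "c \<theta> = exp (\<xi> \<theta>) * cis \<theta>"
  by (simp add: c_def exp_eq_polar)

lemma cpx_bdry: "cpx (bdry h (circ \<theta>)) = c \<theta>"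
  unfolding bdry_def exp_\<xi> by (simp add: c_eq complex_eq_iff cis.ctr)

lemma cpx_star_domain: "cpx ` star_domain h = D"
proof
  show "cpx ` star_domain h \<subseteq> D"
  proof
    fix w assume "w \<in> cpx ` star_domain h"
    then obtain r x where rx: "w = cpx (r *\<^sub>R x)" "x \<in> sphere 0 1" "0 \<le> r" "r < 1 + h x"
      by (auto simp: star_domain_def)
    then obtain \<theta> where x: "x = circ \<theta>" unfolding sphere_eq_range_circ by blast
    show "w \<in> D"
    proof (cases "r = 0")
      case True
      then have "w = 0" using rx(1) by (simp add: complex_eq_iff)
      then show ?thesis by (simp add: D_def)
    next
      case False
      then have r: "r > 0" using rx(3) by simp
      have "w = exp (Complex (ln r) \<theta>)"
        using r by (simp add: rx(1) x complex_eq_iff exp_eq_polar)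
      moreover have "ln r < ln (exp (\<xi> \<theta>))"
        using rx(4) r unfolding x exp_\<xi> by (subst ln_less_cancel_iff) auto
      ultimately show ?thesis by simp
    qed
  qed
  show "D \<subseteq> cpx ` star_domain h"
  proof
    fix w assume w: "w \<in> D"
    have mem: "cpx (r *\<^sub>R circ \<theta>) \<in> cpx ` star_domain h" if "0 \<le> r" "r < exp (\<xi> \<theta>)" for r \<theta>
      using that unfolding star_domain_def exp_\<xi>[symmetric] sphere_eq_range_circ by blast
    show "w \<in> cpx ` star_domain h"
    proof (cases "w = 0")
      case True
      have "cpx (0 *\<^sub>R circ 0) = 0" by (simp add: complex_eq_iff)
      then show ?thesis using mem[of 0 0] True by simp
    next
      case False
      then have "w \<in> exp ` E" using w by (simp add: D_def)
      then obtain u where u: "w = exp u" "Re u < \<xi> (Im u)" by (auto simp: E_def)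
      have "w = cpx (exp (Re u) *\<^sub>R circ (Im u))"
        by (simp add: u(1) complex_eq_iff exp_eq_polar)
      then show ?thesis using mem u(2) by simp
    qed
  qed
qed

lemma open_star_domain: "open (star_domain h)"
proof -
  have "star_domain h = cpx -` D"
    unfolding cpx_star_domain[symmetric] using inj_cpx by (simp add: inj_vimage_image_eq)
  moreover have "continuous_on UNIV cpx"
    using bounded_linear.continuous_on[OF bounded_linear_cpx continuous_on_id] by simp
  ultimately show ?thesis using open_D by (simp add: open_vimage)
qed

lemma cpx_mem_closure: "cpx p \<in> closure D \<longleftrightarrow> p \<in> closure (star_domain h)"
  using inj_cpx by (simp add: cpx_star_domain[symmetric] closure_cpx_image inj_image_mem_iff)

lemma cpx_mem_D: "cpx p \<in> D \<longleftrightarrow> p \<in> star_domain h"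
  using inj_cpx by (simp add: cpx_star_domain[symmetric] inj_image_mem_iff)

lemma cpx_mem_frontier: "cpx p \<in> frontier D \<longleftrightarrow> p \<in> frontier (star_domain h)"
  using open_D open_star_domain by (simp add: frontier_def interior_open cpx_mem_closure cpx_mem_D)

text \<open>The velocity of the boundary curve, (\<xi>' + \<i>) c in complex notation.\<close>

definition T :: "real \<Rightarrow> real \<times> real" where
  "T \<theta> = exp (\<xi> \<theta>) *\<^sub>R (\<xi>' \<theta> * cos \<theta> - sin \<theta>, \<xi>' \<theta> * sin \<theta> + cos \<theta>)"

text \<open>The unit vector along \<open>T\<close> turned clockwise by a right angle: - \<i> (\<xi>'
  + \<i>) = 1 - \<i>\<xi>'.\<close>

definition n :: "real \<Rightarrow> real \<times> real" where
  "n \<theta> = (1 / sqrt (1 + (\<xi>' \<theta>)\<^sup>2)) *\<^sub>R (cos \<theta> + \<xi>' \<theta> * sin \<theta>, sin \<theta> - \<xi>' \<theta> * cos \<theta>)"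

lemma K_pos: "1 + (\<xi>' \<theta>)\<^sup>2 > 0" and sqrt_K_pos: "sqrt (1 + (\<xi>' \<theta>)\<^sup>2) > 0"
  by (simp_all add: add_pos_nonneg)

lemma cpx_n: "cpx (n \<theta>) = cis \<theta> * (1 - \<i> * \<xi>' \<theta>) / sqrt (1 + (\<xi>' \<theta>)\<^sup>2)"
  by (simp add: n_def complex_eq_iff algebra_simps add_divide_distrib diff_divide_distrib)

lemma norm_n: "norm (n \<theta>) = 1"
proof -
  have "(cos \<theta> + \<xi>' \<theta> * sin \<theta>)\<^sup>2 + (sin \<theta> - \<xi>' \<theta> * cos \<theta>)\<^sup>2
      = (1 + (\<xi>' \<theta>)\<^sup>2) * ((sin \<theta>)\<^sup>2 + (cos \<theta>)\<^sup>2)"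
    by algebra
  then have "norm (cos \<theta> + \<xi>' \<theta> * sin \<theta>, sin \<theta> - \<xi>' \<theta> * cos \<theta>) = sqrt (1 + (\<xi>' \<theta>)\<^sup>2)"
    by (simp add: norm_prod_def)
  then show ?thesis using sqrt_K_pos[of \<theta>] by (simp only: n_def norm_scaleR) simp
qed

lemma T_nonzero: "T \<theta> \<noteq> 0"
proof
  assume "T \<theta> = 0"
  then have "\<xi>' \<theta> * cos \<theta> - sin \<theta> = 0" "\<xi>' \<theta> * sin \<theta> + cos \<theta> = 0"
    by (simp_all add: T_def zero_prod_def)
  then have "(sin \<theta>)\<^sup>2 + (cos \<theta>)\<^sup>2 = 0" by algebra
  then show False by simp
qed

text \<open>In the plane the orthogonal complement of \<open>T\<close> is a line, which contains two
  unit vectors. Which of them points outwards is decided by the rays in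
  \<open>normal_ray\<close>.\<close>

lemma unit_orthogonal_T:
  assumes "norm m = 1"
  shows "m \<bullet> T \<theta> = 0 \<longleftrightarrow> m = n \<theta> \<or> m = - n \<theta>"
proof -
  define s where "s = sqrt (1 + (\<xi>' \<theta>)\<^sup>2)"
  have s: "s > 0" "s\<^sup>2 = 1 + (\<xi>' \<theta>)\<^sup>2" using K_pos[of \<theta>] sqrt_K_pos by (auto simp: s_def)
  define x y where "x = fst (n \<theta>)" and "y = snd (n \<theta>)"
  have xy: "n \<theta> = (x, y)" by (simp add: x_def y_def)
  have T_n: "T \<theta> = (exp (\<xi> \<theta>) * s) *\<^sub>R (- y, x)"
    using s(1) by (simp add: T_def x_def y_def n_def s_def[symmetric] algebra_simps)
  obtain a b where m: "m = (a, b)" by (cases m)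
  have nn: "x\<^sup>2 + y\<^sup>2 = 1" using norm_n[of \<theta>] by (simp add: xy norm_prod_def)
  have mm: "a\<^sup>2 + b\<^sup>2 = 1" using assms by (simp add: m norm_prod_def)
  have "m \<bullet> T \<theta> = 0 \<longleftrightarrow> b * x = a * y"
    using s(1) by (auto simp: T_n m algebra_simps)
  also have "\<dots> \<longleftrightarrow> (a = x \<and> b = y) \<or> (a = - x \<and> b = - y)"
  proof
    assume e: "b * x = a * y"
    define t where "t = a * x + b * y"
    have a: "a = t * x" and b: "b = t * y"
      using e nn unfolding t_def by algebra+
    have "t\<^sup>2 = 1" using mm nn unfolding a b by algebra
    then show "(a = x \<and> b = y) \<or> (a = - x \<and> b = - y)"
      using a b by (auto simp: power2_eq_1_iff)
  qed auto
  finally show ?thesis by (simp add: m xy)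
qed

lemma bdry_has_vector_derivative: "((\<lambda>\<theta>. bdry h (circ \<theta>)) has_vector_derivative T \<theta>) (at \<theta>)"
proof -
  have "((\<lambda>\<theta>. exp (\<xi> \<theta>) * cos \<theta>) has_real_derivative fst (T \<theta>)) (at \<theta>)"
    "((\<lambda>\<theta>. exp (\<xi> \<theta>) * sin \<theta>) has_real_derivative snd (T \<theta>)) (at \<theta>)"
    by (rule derivative_eq_intros deriv_\<xi> refl | simp add: T_def right_diff_distrib distrib_left)+
  then show ?thesis
    using has_vector_derivative_Pair[of "\<lambda>\<theta>. exp (\<xi> \<theta>) * cos \<theta>" "fst (T \<theta>)" \<theta> UNIV
        "\<lambda>\<theta>. exp (\<xi> \<theta>) * sin \<theta>" "snd (T \<theta>)"]
    unfolding bdry_def exp_\<xi> by (simp add: has_real_derivative_iff_has_vector_derivative)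
qed

text \<open>The sign \<open>a\<close> treats both rays at once: the one along \<open>n\<close> shows
  that \<open>n\<close> satisfies the definition of the outer normal, the opposite one that
  \<open>- n\<close> does not.\<close>

lemma normal_ray:
  assumes a: "a = 1 \<or> a = (-1 :: real)"
  shows "\<forall>\<^sub>F s in at_right 0. bdry h (circ \<theta>) + s *\<^sub>R (a *\<^sub>R n \<theta>) \<in> closure (star_domain h) \<longleftrightarrow> a = -1"
proof -
  define w where "w = c \<theta>"
  define m where "m = of_real a * cpx (n \<theta>)"
  define k where "k = sqrt (1 + (\<xi>' \<theta>)\<^sup>2)"
  have k: "k > 0" "k\<^sup>2 = 1 + (\<xi>' \<theta>)\<^sup>2" using K_pos[of \<theta>] sqrt_K_pos by (auto simp: k_def)
  have w0: "w \<noteq> 0" "exp (Complex (\<xi> \<theta>) \<theta>) = w" by (simp_all add: w_def c_def)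
  obtain N L where NL: "open N" "w \<in> N" "L w = Complex (\<xi> \<theta>) \<theta>" "\<And>x. x \<in> N \<Longrightarrow> exp (L x) = x"
    and L': "(L has_field_derivative inverse w) (at w)"
    using local_inverse_exp[OF w0] by metis
  define z where "z s = w + of_real s * m" for s
  have z: "cpx (bdry h (circ \<theta>) + s *\<^sub>R (a *\<^sub>R n \<theta>)) = z s" for s
    unfolding z_def w_def cpx_bdry[symmetric] m_def by (simp add: complex_eq_iff)
  have dz: "(z has_derivative (\<lambda>s. of_real s * m)) (at 0)"
    unfolding z_def by (auto intro!: derivative_eq_intros)
  have z0: "z 0 = w" by (simp add: z_def)
  have dL: "((\<lambda>s. L (z s)) has_derivative (\<lambda>s. inverse w * (of_real s * m))) (at 0)"
    using L' by (intro has_derivative_compose[OF dz]) (simp add: z0 has_field_derivative_def)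
  define q where "q = inverse w * m"
  have "(\<lambda>s. Re (inverse w * (of_real s * m))) = (*) (Re q)"
    "(\<lambda>s. Im (inverse w * (of_real s * m))) = (*) (Im q)"
    unfolding q_def mult.left_commute[of "inverse w"] by (simp_all add: fun_eq_iff del: inverse_complex.simps)
  then have Re_L: "((\<lambda>s. Re (L (z s))) has_real_derivative Re q) (at 0)"
    and Im_L: "((\<lambda>s. Im (L (z s))) has_real_derivative Im q) (at 0)"
    using has_derivative_Re[OF dL] has_derivative_Im[OF dL]
    unfolding has_field_derivative_def by (simp_all only:)
  \<comment> \<open>In logarithmic coordinates \<open>\<phi>\<close> is a defining function of the
    domain along the ray: while the ray stays in \<open>N\<close> it is nonpositive exactly on the
    closure, and it vanishes at the start. Its derivative there has the sign of
    \<open>a\<close>.\<close>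
  define \<phi> where "\<phi> s = Re (L (z s)) - \<xi> (Im (L (z s)))" for s
  have d\<phi>: "(\<phi> has_real_derivative (Re q - Im q * \<xi>' \<theta>)) (at 0)"
    unfolding \<phi>_def
    using DERIV_chain'[OF Im_L, of \<xi> "\<xi>' \<theta>"] deriv_\<xi>[of \<theta>]
    by (intro DERIV_diff Re_L) (simp add: z0 NL(3) mult.commute)
  have "q = of_real (a * exp (- \<xi> \<theta>) / k) * (1 - \<i> * \<xi>' \<theta>)"
  proof -
    have "inverse (of_real e * cs) * (of_real a * (cs * x / of_real k)) = of_real (a * inverse e / k) * x"
      if "cs \<noteq> 0" "e \<noteq> 0" for cs x :: complex and e :: real
      using that k(1) by (simp add: field_simps)
    then show ?thesis
      by (simp only: q_def m_def cpx_n w_def c_eq k_def exp_minus cis_neq_zero exp_not_eq_zero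
          not_False_eq_True)
  qed
  then have "Re q - Im q * \<xi>' \<theta> = a * exp (- \<xi> \<theta>) / k * (1 + (\<xi>' \<theta>)\<^sup>2)"
    by (simp only: Re_complex_of_real Im_complex_of_real times_complex.sel) (simp add: power2_eq_square distrib_left)
  also have "\<dots> = a * exp (- \<xi> \<theta>) * k"
    using k(1) unfolding k(2)[symmetric] by (simp add: power2_eq_square)
  finally have dq: "Re q - Im q * \<xi>' \<theta> = a * exp (- \<xi> \<theta>) * k" .
  note d\<phi> = d\<phi>[unfolded dq]
  have \<phi>0: "\<phi> 0 = 0" by (simp add: \<phi>_def z0 NL(3))
  have "isCont z 0" using dz by (rule has_derivative_continuous)
  then have "(z \<longlongrightarrow> w) (at_right 0)"
    by (simp add: isCont_def z0 filterlim_at_split)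
  then have "\<forall>\<^sub>F s in at_right 0. z s \<in> N"
    using NL(1,2) by (rule topological_tendstoD)
  moreover have "\<forall>\<^sub>F s in at_right 0. \<phi> s \<le> 0 \<longleftrightarrow> a = -1"
  proof (cases "a = 1")
    case True
    then obtain d where "d > 0" "\<And>s. 0 < s \<Longrightarrow> s < d \<Longrightarrow> \<phi> 0 < \<phi> (0 + s)"
      using DERIV_pos_inc_right[OF d\<phi>] k(1) by auto
    then show ?thesis
      unfolding eventually_at_right_field using True \<phi>0 by (intro exI[of _ d]) (force simp: not_le)
  next
    case False
    then have a: "a = -1" using a by simp
    then obtain d where "d > 0" "\<And>s. 0 < s \<Longrightarrow> s < d \<Longrightarrow> \<phi> (0 + s) < \<phi> 0"
      using DERIV_neg_dec_right[OF d\<phi>] k(1) by auto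
    then show ?thesis
      unfolding eventually_at_right_field using a \<phi>0 by (intro exI[of _ d]) (auto intro: less_imp_le)
  qed
  ultimately show ?thesis
  proof eventually_elim
    case (elim s)
    have "z s \<in> closure D \<longleftrightarrow> \<phi> s \<le> 0"
      using NL(4)[OF elim(1)] exp_mem_closure_D[of "L (z s)"] by (simp add: \<phi>_def)
    then show ?case using elim(2) unfolding z[symmetric] cpx_mem_closure by simp
  qed
qed

text \<open>The angle read off from a branch of the logarithm inverts the boundary parametrization
  near the given point, because frontier points are determined by their angle.\<close>

lemma secant_tendsto_iff:
  "((\<lambda>q. m \<bullet> sgn (q - bdry h (circ \<theta>))) \<longlongrightarrow> 0) (at (bdry h (circ \<theta>)) within frontier (star_domain h))
    \<longleftrightarrow> m \<bullet> T \<theta> = 0"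
proof -
  define w where "w = c \<theta>"
  have w0: "w \<noteq> 0" "exp (Complex (\<xi> \<theta>) \<theta>) = w" by (simp_all add: w_def c_def)
  obtain N L where NL: "open N" "w \<in> N" "L w = Complex (\<xi> \<theta>) \<theta>" "L holomorphic_on N"
    "\<And>x. x \<in> N \<Longrightarrow> exp (L x) = x"
    using local_inverse_exp[OF w0] by metis
  let ?p = "bdry h (circ \<theta>)" and ?F = "frontier (star_domain h)"
  have bd: "bdry h (circ \<tau>) \<in> ?F" for \<tau>
    unfolding cpx_mem_frontier[symmetric] cpx_bdry c_def by (auto simp: frontier_D)
  have cpx_lim: "(cpx \<longlongrightarrow> w) (at ?p within ?F)"
    using bounded_linear.tendsto[OF bounded_linear_cpx tendsto_ident_at, of ?p ?F] by (simp add: cpx_bdry w_def)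
  then have inN: "\<forall>\<^sub>F q in at ?p within ?F. cpx q \<in> N"
    using NL(1,2) by (rule topological_tendstoD)
  define \<kappa> where "\<kappa> q = Im (L (cpx q))" for q
  have inv: "\<forall>\<^sub>F q in at ?p within ?F. bdry h (circ (\<kappa> q)) = q"
    using inN unfolding eventually_at_filter
  proof (elim eventually_mono, intro impI)
    fix q assume *: "q \<noteq> ?p \<longrightarrow> q \<in> ?F \<longrightarrow> cpx q \<in> N" "q \<noteq> ?p" "q \<in> ?F"
    then have e: "exp (L (cpx q)) = cpx q" using NL(5) by blast
    have "cpx q \<in> frontier D" using *(3) by (simp add: cpx_mem_frontier)
    then obtain u where u: "cpx q = exp u" "Re u = \<xi> (Im u)" unfolding frontier_D by blast
    then have "exp (L (cpx q)) = exp u" using e by simp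
    then have "Re (L (cpx q)) = Re u" "\<xi> (Im (L (cpx q))) = \<xi> (Im u)"
      using exp_eq_imp_Im by (metis norm_exp_eq_Re exp_inj_iff, blast)
    then have "L (cpx q) = Complex (\<xi> (\<kappa> q)) (\<kappa> q)" using u(2) by (simp add: \<kappa>_def complex_eq_iff)
    then have "cpx q = cpx (bdry h (circ (\<kappa> q)))" using e by (simp add: cpx_bdry c_def)
    then show "bdry h (circ (\<kappa> q)) = q" using inj_cpx by (simp only: inj_eq)
  qed
  have "isCont L w"
    using holomorphic_on_imp_continuous_on[OF NL(4)] NL(1,2) continuous_on_eq_continuous_at by blast
  then have "(\<kappa> \<longlongrightarrow> \<theta>) (at ?p within ?F)"
    using tendsto_Im[OF isCont_tendsto_compose[OF _ cpx_lim, of L]] unfolding \<kappa>_def by (simp add: NL(3))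
  moreover have "\<forall>\<^sub>F q in at ?p within ?F. \<kappa> q \<noteq> \<theta>"
    using inv eventually_neq_at_within[of ?p ?p ?F] by eventually_elim auto
  ultimately have "filterlim \<kappa> (at \<theta>) (at ?p within ?F)"
    by (simp add: filterlim_at)
  from inner_sgn_secant_tendsto_0_iff[OF bdry_has_vector_derivative T_nonzero bd this inv]
  show ?thesis .
qed

lemma outer_normal_star_domain: "outer_normal (star_domain h) (bdry h (circ \<theta>)) = n \<theta>"
  unfolding outer_normal_def
proof (rule the_equality, intro conjI norm_n)
  show "((\<lambda>q. n \<theta> \<bullet> sgn (q - bdry h (circ \<theta>))) \<longlongrightarrow> 0) (at (bdry h (circ \<theta>)) within frontier (star_domain h))"
    using unit_orthogonal_T[OF norm_n] by (simp add: secant_tendsto_iff)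
  show "\<forall>\<^sub>F s in at_right 0. bdry h (circ \<theta>) + s *\<^sub>R n \<theta> \<notin> closure (star_domain h)"
    using normal_ray[of 1 \<theta>] by simp
next
  fix m assume m: "norm m = 1 \<and>
      ((\<lambda>q. m \<bullet> sgn (q - bdry h (circ \<theta>))) \<longlongrightarrow> 0) (at (bdry h (circ \<theta>)) within frontier (star_domain h)) \<and>
      (\<forall>\<^sub>F s in at_right 0. bdry h (circ \<theta>) + s *\<^sub>R m \<notin> closure (star_domain h))"
  then have "m = n \<theta> \<or> m = - n \<theta>" using unit_orthogonal_T[of m \<theta>] by (simp add: secant_tendsto_iff)
  moreover have "m \<noteq> - n \<theta>"
  proof
    assume "m = - n \<theta>"
    have "\<forall>\<^sub>F s in at_right 0. bdry h (circ \<theta>) + s *\<^sub>R m \<notin> closure (star_domain h)"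
      using m by blast
    moreover have "\<forall>\<^sub>F s in at_right 0. bdry h (circ \<theta>) + s *\<^sub>R m \<in> closure (star_domain h)"
      using normal_ray[of "-1" \<theta>] \<open>m = - n \<theta>\<close> by simp
    ultimately have "\<forall>\<^sub>F s in at_right (0::real). False"
      by eventually_elim simp
    then show False by simp
  qed
  ultimately show "m = n \<theta>" by blast
qed

end

section \<open>The two Dirichlet-Neumann operators\<close>

lemma cgrad_of: "cgrad (\<lambda>p. pt (cnj (G (cpx p)))) = G"
  by (rule ext) (simp add: cgrad_def)

lemma Re_of_real_mult: "Re (of_real a * z) = a * Re z"
  by simp

lemma cpx_below_graph: "cpx ` below_graph \<xi> = {z. Re z < \<xi> (Im z)}"
proof -
  have "z \<in> cpx ` below_graph \<xi>" if "Re z < \<xi> (Im z)" for z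
    using that by (intro image_eqI[of _ _ "pt z"]) (simp_all add: below_graph_def case_prod_beta)
  then show ?thesis by (auto simp: below_graph_def)
qed

context circle_domain
begin

definition disc_solution :: "(real \<times> real \<Rightarrow> real) \<Rightarrow> (complex \<Rightarrow> real) \<Rightarrow> (complex \<Rightarrow> complex) \<Rightarrow> bool" where
  "disc_solution \<psi> f g \<longleftrightarrow> potential_on D f g \<and> (\<forall>\<theta>. f (c \<theta>) = \<psi> (circ \<theta>))"

definition torus_solution :: "(real \<times> real \<Rightarrow> real) \<Rightarrow> (complex \<Rightarrow> real) \<Rightarrow> (complex \<Rightarrow> complex) \<Rightarrow> bool" where
  "torus_solution \<psi> F G \<longleftrightarrow> potential_on E F G \<and> (\<forall>z. F (z + 2 * pi * \<i>) = F z) \<and>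
     (\<forall>\<theta>. F (Complex (\<xi> \<theta>) \<theta>) = \<psi> (circ \<theta>)) \<and>
     (\<forall>\<epsilon>>0. \<exists>\<rho>. \<forall>z. Re z \<le> \<rho> \<longrightarrow> \<bar>Re (G z)\<bar> < \<epsilon>)"

lemma bdry_in_closure: "c \<theta> \<in> closure D" "Complex (\<xi> \<theta>) \<theta> \<in> closure E"
  by (simp_all add: c_def closure_E)

lemma bounded_potential_on_D: "potential_on D f g \<Longrightarrow> bounded (g ` closure D)"
  using potential_onD(1) compact_closure_D by (blast intro: compact_imp_bounded compact_continuous_image)

lemma disc_potential_iff: "disc_potential h \<psi> \<Phi> V \<longleftrightarrow> disc_solution \<psi> (\<Phi> \<circ> pt) (cgrad V)"
proof -
  have "bounded (V ` star_domain h)" if P: "potential_on D (\<Phi> \<circ> pt) (cgrad V)"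
  proof -
    obtain B where B: "\<And>z. z \<in> closure D \<Longrightarrow> norm (cgrad V z) \<le> B"
      using bounded_potential_on_D[OF P] by (auto simp: bounded_iff)
    have "norm (V p) \<le> B" if "p \<in> star_domain h" for p
      using B[of "cpx p"] that closure_subset[of D] cpx_mem_D[of p] by (auto simp: cgrad_def)
    then show ?thesis unfolding bounded_iff by blast
  qed
  moreover have "(\<forall>x\<in>sphere 0 1. \<Phi> (bdry h x) = \<psi> x) \<longleftrightarrow> (\<forall>\<theta>. (\<Phi> \<circ> pt) (c \<theta>) = \<psi> (circ \<theta>))"
    unfolding sphere_eq_range_circ cpx_bdry[symmetric] by simp
  ultimately show ?thesis
    unfolding disc_potential_def disc_solution_def
    using potential_on_cpx_image[OF open_star_domain, of \<Phi> V] cpx_star_domain by auto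
qed

lemma torus_potential_iff:
  assumes chi: "\<And>\<theta>. chi \<theta> = \<psi> (circ \<theta>)"
  shows "torus_potential \<xi> chi \<Phi> V \<longleftrightarrow> torus_solution \<psi> (\<Phi> \<circ> pt) (cgrad V)"
proof -
  have "open (below_graph \<xi>)"
  proof -
    have "below_graph \<xi> = cpx -` E"
      by (auto simp: below_graph_def E_def)
    moreover have "continuous_on UNIV cpx"
      using bounded_linear.continuous_on[OF bounded_linear_cpx continuous_on_id] by simp
    ultimately show ?thesis using open_E by (simp add: open_vimage)
  qed
  from potential_on_cpx_image[OF this, of \<Phi> V]
  have 1: "potential_on E (\<Phi> \<circ> pt) (cgrad V) \<longleftrightarrow>
      has_gradient_on \<Phi> V (closure (below_graph \<xi>)) \<and> harmonic_on \<Phi> (below_graph \<xi>)"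
    unfolding cpx_below_graph E_def .
  have 2: "(\<forall>\<rho> \<theta>. \<Phi> (\<rho>, \<theta> + 2 * pi) = \<Phi> (\<rho>, \<theta>)) \<longleftrightarrow> (\<forall>z. (\<Phi> \<circ> pt) (z + 2 * pi * \<i>) = (\<Phi> \<circ> pt) z)"
  proof (intro iffI allI)
    fix z assume "\<forall>\<rho> \<theta>. \<Phi> (\<rho>, \<theta> + 2 * pi) = \<Phi> (\<rho>, \<theta>)"
    then show "(\<Phi> \<circ> pt) (z + 2 * pi * \<i>) = (\<Phi> \<circ> pt) z" by (simp add: pt_def)
  next
    fix \<rho> \<theta> assume *: "\<forall>z. (\<Phi> \<circ> pt) (z + 2 * pi * \<i>) = (\<Phi> \<circ> pt) z"
    show "\<Phi> (\<rho>, \<theta> + 2 * pi) = \<Phi> (\<rho>, \<theta>)" using spec[OF *, of "Complex \<rho> \<theta>"] by (simp add: pt_def)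
  qed
  have 3: "(\<forall>\<theta>. \<Phi> (\<xi> \<theta>, \<theta>) = chi \<theta>) \<longleftrightarrow> (\<forall>\<theta>. (\<Phi> \<circ> pt) (Complex (\<xi> \<theta>) \<theta>) = \<psi> (circ \<theta>))"
    by (simp add: chi pt_def)
  have 4: "uniform_limit UNIV (\<lambda>\<rho> \<theta>. fst (V (\<rho>, \<theta>))) (\<lambda>\<theta>. 0) at_bot \<longleftrightarrow>
      (\<forall>\<epsilon>>0. \<exists>\<rho>. \<forall>z. Re z \<le> \<rho> \<longrightarrow> \<bar>Re (cgrad V z)\<bar> < \<epsilon>)"
  proof -
    have "(\<forall>\<rho>'\<le>\<rho>. \<forall>\<theta>\<in>UNIV. dist (fst (V (\<rho>', \<theta>))) 0 < \<epsilon>) \<longleftrightarrow>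
        (\<forall>z. Re z \<le> \<rho> \<longrightarrow> \<bar>Re (cgrad V z)\<bar> < \<epsilon>)" for \<rho> \<epsilon>
    proof (intro iffI allI impI ballI)
      fix z assume "\<forall>\<rho>'\<le>\<rho>. \<forall>\<theta>\<in>UNIV. dist (fst (V (\<rho>', \<theta>))) 0 < \<epsilon>" "Re z \<le> \<rho>"
      then show "\<bar>Re (cgrad V z)\<bar> < \<epsilon>" by (simp add: cgrad_def pt_def)
    next
      fix \<rho>' \<theta> assume *: "\<forall>z. Re z \<le> \<rho> \<longrightarrow> \<bar>Re (cgrad V z)\<bar> < \<epsilon>" "\<rho>' \<le> \<rho>"
      then show "dist (fst (V (\<rho>', \<theta>))) 0 < \<epsilon>"
        using spec[OF *(1), of "Complex \<rho>' \<theta>"] by (simp add: cgrad_def pt_def)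
    qed
    then show ?thesis unfolding uniform_limit_iff eventually_at_bot_linorder by simp
  qed
  show ?thesis unfolding torus_potential_def torus_solution_def 1 2 3 4 by blast
qed

lemma disc_solution_unique:
  "disc_solution \<psi> f1 g1 \<Longrightarrow> disc_solution \<psi> f2 g2 \<Longrightarrow> z \<in> closure D \<Longrightarrow> g1 z = g2 z"
  by (rule potential_on_D_unique[of f1 g1 f2 g2]) (auto simp: disc_solution_def c_def)

text \<open>The gradient in the disc is bounded, so its pull-back is at most a constant times
  \<open>exp (Re z)\<close>; this is the source of the uniform decay.\<close>

lemma disc_imp_torus_solution:
  assumes "disc_solution \<psi> f g"
  shows "torus_solution \<psi> (f \<circ> exp) (\<lambda>z. g (exp z) * exp z)"
proof -
  have fg: "potential_on D f g" using assms by (simp add: disc_solution_def)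
  have "\<exists>\<rho>. \<forall>z. Re z \<le> \<rho> \<longrightarrow> \<bar>Re (g (exp z) * exp z)\<bar> < \<epsilon>" if \<epsilon>: "\<epsilon> > 0" for \<epsilon>
  proof -
    obtain b where b: "\<And>\<theta>. \<bar>\<xi> \<theta>\<bar> \<le> b" using bounded_range by (auto simp: bounded_iff)
    obtain B where B: "B > 0" "\<And>z. z \<in> closure D \<Longrightarrow> norm (g z) \<le> B"
      using bounded_potential_on_D[OF fg] by (auto simp: bounded_pos)
    \<comment> \<open>The bound \<open>- b\<close> puts every such point into the closure of
      \<open>E\<close>; the logarithm makes \<open>B * exp (Re z)\<close> at most half of
      \<epsilon>, hence strictly smaller.\<close>
    have "\<bar>Re (g (exp z) * exp z)\<bar> < \<epsilon>" if z: "Re z \<le> min (- b) (ln (\<epsilon> / (2 * B)))" for z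
    proof -
      have "exp z \<in> closure D" using z b[of "Im z"] by (auto simp: abs_le_iff)
      have "\<bar>Re (g (exp z) * exp z)\<bar> \<le> norm (g (exp z) * exp z)" by (rule abs_Re_le_cmod)
      also have "\<dots> \<le> B * exp (ln (\<epsilon> / (2 * B)))"
        unfolding norm_mult norm_exp_eq_Re using B \<open>exp z \<in> closure D\<close> z
        by (intro mult_mono) auto
      also have "\<dots> < \<epsilon>" using B \<epsilon> by simp
      finally show ?thesis .
    qed
    then show ?thesis by blast
  qed
  moreover have "(f \<circ> exp) (z + 2 * pi * \<i>) = (f \<circ> exp) z" for z
  proof -
    have "exp (z + 2 * pi * \<i>) = exp z" by (subst exp_eq) (rule exI[of _ 1], simp)
    then show ?thesis by simp
  qed
  moreover have "(f \<circ> exp) (Complex (\<xi> \<theta>) \<theta>) = \<psi> (circ \<theta>)" for \<theta>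
    using assms by (simp add: disc_solution_def c_def)
  ultimately show ?thesis
    unfolding torus_solution_def using potential_on_D_imp_E[OF fg] by blast
qed

lemma torus_imp_disc_solution:
  assumes "torus_solution \<psi> F G"
  shows "\<exists>f g. disc_solution \<psi> f g \<and> (\<forall>z\<in>closure E. g (exp z) * exp z = G z)"
proof -
  have FG: "potential_on E F G" "\<And>z. F (z + 2 * pi * \<i>) = F z"
    and bd: "\<And>\<theta>. F (Complex (\<xi> \<theta>) \<theta>) = \<psi> (circ \<theta>)"
    and lim: "\<And>\<epsilon>. \<epsilon> > 0 \<Longrightarrow> \<exists>\<rho>. \<forall>z. Re z \<le> \<rho> \<longrightarrow> \<bar>Re (G z)\<bar> < \<epsilon>"
    using assms by (auto simp: torus_solution_def)
  have "\<exists>\<rho>. \<forall>z\<in>E. Re z < \<rho> \<longrightarrow> \<bar>Re (G z)\<bar> < \<epsilon>" if "\<epsilon> > 0" for \<epsilon>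
    using lim[OF that] by (meson less_imp_le)
  from potential_on_E_imp_D[OF FG this] obtain f g where fg: "potential_on D f g"
    "\<And>z. z \<in> closure E \<Longrightarrow> f (exp z) = F z" "\<And>z. z \<in> closure E \<Longrightarrow> g (exp z) * exp z = G z"
    by blast
  have "disc_solution \<psi> f g"
    using fg(1,2) bdry_in_closure(2) bd by (simp add: disc_solution_def c_def)
  then show ?thesis using fg(3) by blast
qed

text \<open>The gradient is unique up to the boundary, so every solution gives the same normal
  derivative and the definite description in the operator is well defined.\<close>

lemma DN_circle_eq:
  assumes fg: "disc_solution \<psi> f g"
  shows "DN_circle h \<psi> (circ \<theta>) = Re (g (c \<theta>) * cpx (n \<theta>))"
proof -
  have val: "V (bdry h (circ \<theta>)) \<bullet> outer_normal (star_domain h) (bdry h (circ \<theta>)) = Re (g (c \<theta>) * cpx (n \<theta>))"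
    if "disc_potential h \<psi> \<Phi> V" for \<Phi> V
  proof -
    have "cgrad V (c \<theta>) = g (c \<theta>)"
      using disc_solution_unique[OF _ fg bdry_in_closure(1)] that by (simp add: disc_potential_iff)
    then show ?thesis
      using inner_cgrad[of V "c \<theta>" "cpx (n \<theta>)"]
      by (simp add: outer_normal_star_domain flip: cpx_bdry del: times_complex.sel)
  qed
  define \<Phi> V where "\<Phi> = f \<circ> cpx" and "V = (\<lambda>p. pt (cnj (g (cpx p))))"
  have "f \<circ> cpx \<circ> pt = f" by (simp add: fun_eq_iff)
  then have ex: "disc_potential h \<psi> \<Phi> V"
    using fg by (simp add: disc_potential_iff \<Phi>_def V_def cgrad_of)
  then have "\<exists>\<Phi> V. disc_potential h \<psi> \<Phi> V" by blast
  then have "DN_circle h \<psi> (circ \<theta>) = (THE v. \<exists>\<Phi> V. disc_potential h \<psi> \<Phi> V \<and>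
      v = V (bdry h (circ \<theta>)) \<bullet> outer_normal (star_domain h) (bdry h (circ \<theta>)))"
    unfolding DN_circle_def by (rule if_P)
  also have "\<dots> = Re (g (c \<theta>) * cpx (n \<theta>))"
    by (rule the_equality) (use ex val in \<open>metis, metis\<close>)
  finally show ?thesis .
qed

text \<open>Any competing potential on the half-cylinder descends to the disc, where its gradient
  must be g. Encoding (a, b) as a - \<i>b, the real part of its product with 1 - \<i>\<xi>' is a -
  \<xi>' b, the derivative that defines the operator.\<close>

lemma DN_torus_eq:
  assumes fg: "disc_solution \<psi> f g" and chi: "\<And>\<theta>. chi \<theta> = \<psi> (circ \<theta>)"
  shows "DN_torus \<xi> chi \<theta> = Re (g (c \<theta>) * c \<theta> * (1 - \<i> * \<xi>' \<theta>))"
proof -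
  have deriv: "deriv \<xi> \<theta> = \<xi>' \<theta>" using deriv_\<xi> by (rule DERIV_imp_deriv)
  have val: "fst (V (\<xi> \<theta>, \<theta>)) - deriv \<xi> \<theta> * snd (V (\<xi> \<theta>, \<theta>)) = Re (g (c \<theta>) * c \<theta> * (1 - \<i> * \<xi>' \<theta>))"
    if "torus_potential \<xi> chi \<Phi> V" for \<Phi> V
  proof -
    have "torus_solution \<psi> (\<Phi> \<circ> pt) (cgrad V)" using that torus_potential_iff chi by blast
    then obtain f2 g2 where fg2: "disc_solution \<psi> f2 g2" "\<And>z. z \<in> closure E \<Longrightarrow> g2 (exp z) * exp z = cgrad V z"
      using torus_imp_disc_solution by blast
    have "cgrad V (Complex (\<xi> \<theta>) \<theta>) = g2 (c \<theta>) * c \<theta>"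
      using fg2(2)[OF bdry_in_closure(2)] by (simp add: c_def)
    also have "g2 (c \<theta>) = g (c \<theta>)"
      using disc_solution_unique[OF fg2(1) fg bdry_in_closure(1)] .
    finally have *: "cgrad V (Complex (\<xi> \<theta>) \<theta>) = g (c \<theta>) * c \<theta>" .
    have "fst (V (\<xi> \<theta>, \<theta>)) - \<xi>' \<theta> * snd (V (\<xi> \<theta>, \<theta>)) = Re (cgrad V (Complex (\<xi> \<theta>) \<theta>) * (1 - \<i> * \<xi>' \<theta>))"
      by (simp add: cgrad_def pt_def)
    then show ?thesis unfolding * deriv .
  qed
  define \<Phi> V where "\<Phi> = f \<circ> exp \<circ> cpx" and "V = (\<lambda>p. pt (cnj (g (exp (cpx p)) * exp (cpx p))))"
  have "f \<circ> exp \<circ> cpx \<circ> pt = f \<circ> exp" by (simp add: fun_eq_iff)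
  then have ex: "torus_potential \<xi> chi \<Phi> V"
    using disc_imp_torus_solution[OF fg] cgrad_of[of "\<lambda>z. g (exp z) * exp z"] chi
    by (simp add: torus_potential_iff[of chi \<psi>] \<Phi>_def V_def)
  then have "\<exists>\<Phi> V. torus_potential \<xi> chi \<Phi> V" by blast
  then have "DN_torus \<xi> chi \<theta> = (THE v. \<exists>\<Phi> V. torus_potential \<xi> chi \<Phi> V \<and>
      v = fst (V (\<xi> \<theta>, \<theta>)) - deriv \<xi> \<theta> * snd (V (\<xi> \<theta>, \<theta>)))"
    unfolding DN_torus_def by (rule if_P)
  also have "\<dots> = Re (g (c \<theta>) * c \<theta> * (1 - \<i> * \<xi>' \<theta>))"
    by (rule the_equality) (use ex val in \<open>metis, metis\<close>)
  finally show ?thesis .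
qed

text \<open>Both operators pair g with the direction
  \<open>cis \<theta> * (1 - \<i> * \<xi>' \<theta>)\<close>: on the circle it is normalized to unit
  length, on the torus it carries the factor \<open>exp (\<xi> \<theta>)\<close> from the derivative
  of the exponential. The stated factor is the quotient.\<close>

lemma DN_circle_eq_DN_torus:
  assumes chi: "\<And>\<theta>. chi \<theta> = \<psi> (circ \<theta>)"
  shows "DN_circle h \<psi> (circ \<theta>) = exp (- \<xi> \<theta>) / sqrt (1 + (\<xi>' \<theta>)\<^sup>2) * DN_torus \<xi> chi \<theta>"
proof (cases "\<exists>f g. disc_solution \<psi> f g")
  case True
  then obtain f g where fg: "disc_solution \<psi> f g" by blast
  have "g (c \<theta>) * cpx (n \<theta>) = of_real (exp (- \<xi> \<theta>) / sqrt (1 + (\<xi>' \<theta>)\<^sup>2)) * (g (c \<theta>) * c \<theta> * (1 - \<i> * \<xi>' \<theta>))"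
  proof -
    have "x * (y * u / of_real k) = of_real (inverse e / k) * (x * (of_real e * y) * u)"
      if "e \<noteq> 0" "k > 0" for x y u :: complex and e k :: real
      using that by (simp add: field_simps)
    from this[of "exp (\<xi> \<theta>)" "sqrt (1 + (\<xi>' \<theta>)\<^sup>2)" "g (c \<theta>)" "cis \<theta>" "1 - \<i> * \<xi>' \<theta>"]
    show ?thesis
      unfolding cpx_n exp_minus c_eq[symmetric] using sqrt_K_pos[of \<theta>] by (simp only: exp_not_eq_zero not_False_eq_True)
  qed
  then show ?thesis
    unfolding DN_circle_eq[OF fg] DN_torus_eq[OF fg chi] by (simp del: times_complex.sel add: Re_of_real_mult)
next
  \<comment> \<open>Solutions on the two sides correspond, so if one operator falls back on its
    default value 0, so does the other.\<close>
  case False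
  then have "\<not> (\<exists>\<Phi> V. disc_potential h \<psi> \<Phi> V)" "\<not> (\<exists>\<Phi> V. torus_potential \<xi> chi \<Phi> V)"
    using disc_potential_iff torus_potential_iff[of chi \<psi>, OF chi] torus_imp_disc_solution by blast+
  then show ?thesis by (simp add: DN_circle_def DN_torus_def)
qed

end

section \<open>The equations of motion\<close>

lemma log_C2_on_circle:
  assumes k: "C2_on_circle k" "\<And>\<theta>. k (circ \<theta>) > -1"
  obtains \<xi>1 \<xi>2 where "\<And>\<theta>. ((\<lambda>\<theta>. ln (1 + k (circ \<theta>))) has_real_derivative \<xi>1 \<theta>) (at \<theta>)"
    "\<And>\<theta>. (\<xi>1 has_real_derivative \<xi>2 \<theta>) (at \<theta>)"
proof -
  obtain k1 k2 where k': "\<And>\<theta>. ((\<lambda>\<theta>. k (circ \<theta>)) has_real_derivative k1 \<theta>) (at \<theta>)"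
    "\<And>\<theta>. (k1 has_real_derivative k2 \<theta>) (at \<theta>)"
    using k(1) unfolding C2_on_circle_def by blast
  have pos: "1 + k (circ \<theta>) > 0" for \<theta> using k(2)[of \<theta>] by simp
  have "((\<lambda>\<theta>. ln (1 + k (circ \<theta>))) has_real_derivative k1 \<theta> / (1 + k (circ \<theta>))) (at \<theta>)" for \<theta>
    using pos[of \<theta>] by (auto intro!: derivative_eq_intros k' simp: divide_inverse)
  moreover have "((\<lambda>\<theta>. k1 \<theta> / (1 + k (circ \<theta>))) has_real_derivative
      (k2 \<theta> * (1 + k (circ \<theta>)) - k1 \<theta> * (0 + k1 \<theta>)) / ((1 + k (circ \<theta>)) * (1 + k (circ \<theta>)))) (at \<theta>)" for \<theta>
    using pos[of \<theta>] by (intro DERIV_divide DERIV_add DERIV_const k') simp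
  ultimately show thesis by (rule that)
qed

context circle_domain
begin

lemma h_circ: "h (circ \<theta>) = exp (\<xi> \<theta>) - 1"
  using exp_\<xi>[of \<theta>] by simp

lemma circle_grad_h: "circle_grad h (circ \<theta>) = (exp (\<xi> \<theta>) * \<xi>' \<theta>) *\<^sub>R (- sin \<theta>, cos \<theta>)"
proof (rule circle_grad_circ)
  show "((\<lambda>\<theta>. h (circ \<theta>)) has_real_derivative exp (\<xi> \<theta>) * \<xi>' \<theta>) (at \<theta>)"
    unfolding h_circ by (auto intro!: derivative_eq_intros deriv_\<xi>)
qed

lemma arclength_factor:
  "sqrt ((1 + h (circ \<theta>))\<^sup>2 + (norm (circle_grad h (circ \<theta>)))\<^sup>2) = exp (\<xi> \<theta>) * sqrt (1 + (\<xi>' \<theta>)\<^sup>2)"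
proof -
  have "(1 + h (circ \<theta>))\<^sup>2 + (norm (circle_grad h (circ \<theta>)))\<^sup>2 = (exp (\<xi> \<theta>))\<^sup>2 * (1 + (\<xi>' \<theta>)\<^sup>2)"
    unfolding circle_grad_h exp_\<xi> norm_scaleR by (simp add: norm_prod_def power_mult_distrib distrib_left)
  then show ?thesis by (simp add: real_sqrt_mult)
qed

text \<open>The leading factor \<open>exp (\<xi> \<theta>)\<close> is the one that relates the time
  derivatives of h and \<xi>. The square root, the speed of the boundary curve, cancels the
  normalization of the normal.\<close>

lemma kinematic_rhs:
  assumes chi: "\<And>\<theta>. chi \<theta> = \<psi> (circ \<theta>)"
  shows "sqrt ((1 + h (circ \<theta>))\<^sup>2 + (norm (circle_grad h (circ \<theta>)))\<^sup>2) / (1 + h (circ \<theta>)) * DN_circle h \<psi> (circ \<theta>)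
    = exp (\<xi> \<theta>) * (exp (- 2 * \<xi> \<theta>) * DN_torus \<xi> chi \<theta>)"
proof -
  have "exp (- 2 * \<xi> \<theta>) = exp (- \<xi> \<theta>) * exp (- \<xi> \<theta>)" by (simp flip: exp_add)
  then show ?thesis
    unfolding arclength_factor
    unfolding exp_\<xi> DN_circle_eq_DN_torus[of chi \<psi>, OF chi]
    using sqrt_K_pos[of \<theta>] by (simp add: exp_minus)
qed

text \<open>The surface tension is grouped differently on the two sides: the derivative part of the
  curvature moves into the bracket, which explains its factor exp \<xi> there, while the other part
  stays with the constant 1.\<close>

lemma dynamic_rhs:
  fixes \<sigma>\<^sub>0 :: real
  assumes chi: "\<And>\<theta>. chi \<theta> = \<psi> (circ \<theta>)" and dchi: "(chi has_real_derivative chi') (at \<theta>)"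
    and d2: "(\<xi>' has_real_derivative \<xi>2) (at \<theta>)"
  shows "1/2 * (DN_circle h \<psi> (circ \<theta>)
        + circle_grad \<psi> (circ \<theta>) \<bullet> circle_grad h (circ \<theta>)
          / ((1 + h (circ \<theta>)) * sqrt ((1 + h (circ \<theta>))\<^sup>2 + (norm (circle_grad h (circ \<theta>)))\<^sup>2)))\<^sup>2
      - (norm (circle_grad \<psi> (circ \<theta>)))\<^sup>2 / (2 * (1 + h (circ \<theta>))\<^sup>2)
      - \<sigma>\<^sub>0 * (curvature_at h (circ \<theta>) - 1)
    = exp (- 2 * \<xi> \<theta>)
        * (1/2 * ((DN_torus \<xi> chi \<theta> + deriv \<xi> \<theta> * deriv chi \<theta>) / sqrt (1 + (deriv \<xi> \<theta>)\<^sup>2))\<^sup>2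
           - 1/2 * (deriv chi \<theta>)\<^sup>2
           + \<sigma>\<^sub>0 * exp (\<xi> \<theta>) * deriv (\<lambda>\<theta>. deriv \<xi> \<theta> / sqrt (1 + (deriv \<xi> \<theta>)\<^sup>2)) \<theta>)
      - \<sigma>\<^sub>0 * (exp (- \<xi> \<theta>) * (1 / sqrt (1 + (deriv \<xi> \<theta>)\<^sup>2)) - 1)"
proof -
  have deriv_eq: "deriv \<xi> = \<xi>'" using deriv_\<xi> by (auto intro: DERIV_imp_deriv)
  have deriv_chi: "deriv chi \<theta> = chi'" using dchi by (rule DERIV_imp_deriv)
  have "chi = (\<lambda>\<theta>. \<psi> (circ \<theta>))" using chi by (rule ext)
  with dchi have "((\<lambda>\<theta>. \<psi> (circ \<theta>)) has_real_derivative chi') (at \<theta>)" by simp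
  then have grad_psi: "circle_grad \<psi> (circ \<theta>) = chi' *\<^sub>R (- sin \<theta>, cos \<theta>)" by (rule circle_grad_circ)
  define d where "d = deriv (\<lambda>\<theta>. \<xi>' \<theta> / sqrt (1 + (\<xi>' \<theta>)\<^sup>2)) \<theta>"
  define s where "s = sqrt (1 + (\<xi>' \<theta>)\<^sup>2)"
  define e where "e = exp (\<xi> \<theta>)"
  define p where "p = \<xi>' \<theta>"
  define G where "G = DN_torus \<xi> chi \<theta>"
  have pos: "e > 0" "s > 0" using sqrt_K_pos by (simp_all add: e_def s_def)
  have e_inv: "exp (- \<xi> \<theta>) = inverse e" "exp (- 2 * \<xi> \<theta>) = inverse e * inverse e"
    by (simp_all add: e_def flip: exp_minus exp_add)
  have unit: "(- sin \<theta>, cos \<theta>) \<bullet> (- sin \<theta>, cos \<theta>) = 1"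
    by (simp flip: power2_eq_square)
  have norm_psi: "(norm (chi' *\<^sub>R (- sin \<theta>, cos \<theta>)))\<^sup>2 = chi'\<^sup>2"
  proof -
    have "norm (- sin \<theta>, cos \<theta>) = 1" by (simp add: norm_prod_def)
    then show ?thesis unfolding norm_scaleR by simp
  qed
  have inner: "(chi' *\<^sub>R (- sin \<theta>, cos \<theta>)) \<bullet> ((e * p) *\<^sub>R (- sin \<theta>, cos \<theta>)) = chi' * (e * p)"
    unfolding inner_scaleR_left inner_scaleR_right unit by simp
  \<comment> \<open>For positive e and s this is an identity of rational functions.\<close>
  have "1/2 * (inverse e / s * G + chi' * (e * p) / (e * (e * s)))\<^sup>2 - chi'\<^sup>2 / (2 * e\<^sup>2)
      - \<sigma>\<^sub>0 * (inverse e * (1 / s - d) - 1)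
    = inverse e * inverse e * (1/2 * ((G + p * chi') / s)\<^sup>2 - 1/2 * chi'\<^sup>2 + \<sigma>\<^sub>0 * e * d)
      - \<sigma>\<^sub>0 * (inverse e * (1 / s) - 1)"
    using pos by (simp add: field_simps power2_eq_square)
  then show ?thesis
    unfolding arclength_factor
    unfolding exp_\<xi> DN_circle_eq_DN_torus[of chi \<psi>, OF chi] circle_grad_h grad_psi
      curvature_at_circ[OF exp_\<xi> deriv_\<xi> d2] deriv_eq deriv_chi
    unfolding s_def[symmetric] d_def[symmetric] e_inv
    unfolding e_def[symmetric] p_def[symmetric] G_def[symmetric] norm_psi inner .
qed

end

theorem theorem3p2:
  fixes \<sigma>\<^sub>0 :: real
    and h \<psi> :: "real \<Rightarrow> real \<times> real \<Rightarrow> real"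
    and \<xi> chi :: "real \<Rightarrow> real \<Rightarrow> real"
  assumes h_gt: "\<And>t x. x \<in> sphere 0 1 \<Longrightarrow> h t x > -1"
    and h_C2: "\<And>t. C2_on_circle (h t)"
    and psi_C2: "\<And>t. C2_on_circle (\<psi> t)"
    and xi_eq: "\<And>t \<theta>. \<xi> t \<theta> = ln (1 + h t (cos \<theta>, sin \<theta>))"
    and chi_eq: "\<And>t \<theta>. chi t \<theta> = \<psi> t (cos \<theta>, sin \<theta>)"
  shows
    "(\<forall>t. \<forall>x\<in>sphere 0 1.
        ((\<lambda>t. h t x) has_real_derivative
           sqrt ((1 + h t x)\<^sup>2 + (norm (circle_grad (h t) x))\<^sup>2) / (1 + h t x)
             * DN_circle (h t) (\<psi> t) x) (at t) \<and>
        ((\<lambda>t. \<psi> t x) has_real_derivative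
           1/2 * (DN_circle (h t) (\<psi> t) x
                  + circle_grad (\<psi> t) x \<bullet> circle_grad (h t) x
                    / ((1 + h t x) * sqrt ((1 + h t x)\<^sup>2 + (norm (circle_grad (h t) x))\<^sup>2)))\<^sup>2
           - (norm (circle_grad (\<psi> t) x))\<^sup>2 / (2 * (1 + h t x)\<^sup>2)
           - \<sigma>\<^sub>0 * (curvature_at (h t) x - 1)) (at t))
     \<longleftrightarrow>
     (\<forall>t \<theta>.
        ((\<lambda>t. \<xi> t \<theta>) has_real_derivative
           exp (- 2 * \<xi> t \<theta>) * DN_torus (\<xi> t) (chi t) \<theta>) (at t) \<and>
        ((\<lambda>t. chi t \<theta>) has_real_derivative
           exp (- 2 * \<xi> t \<theta>)
             * (1/2 * ((DN_torus (\<xi> t) (chi t) \<theta> + deriv (\<xi> t) \<theta> * deriv (chi t) \<theta>)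
                       / sqrt (1 + (deriv (\<xi> t) \<theta>)\<^sup>2))\<^sup>2
                - 1/2 * (deriv (chi t) \<theta>)\<^sup>2
                + \<sigma>\<^sub>0 * exp (\<xi> t \<theta>)
                  * deriv (\<lambda>\<theta>. deriv (\<xi> t) \<theta> / sqrt (1 + (deriv (\<xi> t) \<theta>)\<^sup>2)) \<theta>)
           - \<sigma>\<^sub>0 * (exp (- \<xi> t \<theta>) * (1 / sqrt (1 + (deriv (\<xi> t) \<theta>)\<^sup>2)) - 1)) (at t))"
    (is "(\<forall>t. \<forall>x\<in>sphere 0 1. ?lhs t x) \<longleftrightarrow> (\<forall>t \<theta>. ?rhs t \<theta>)")
proof -
  have circ_mem: "circ \<theta> \<in> sphere 0 1" for \<theta> by (simp add: norm_prod_def)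
  have pos: "h t (circ \<theta>) > -1" for t \<theta> using h_gt[OF circ_mem] .
  have exp_xi: "1 + h t (circ \<theta>) = exp (\<xi> t \<theta>)" for t \<theta>
  proof -
    have "1 + h t (circ \<theta>) > 0" using pos[of t \<theta>] by linarith
    then show ?thesis by (simp add: xi_eq)
  qed
  have domain: "\<exists>\<xi>1 \<xi>2. circle_domain (h t) (\<xi> t) \<xi>1 \<and> (\<forall>\<theta>. (\<xi>1 has_real_derivative \<xi>2 \<theta>) (at \<theta>))" for t
  proof -
    obtain \<xi>1 \<xi>2 where d: "\<And>\<theta>. ((\<lambda>\<theta>. ln (1 + h t (circ \<theta>))) has_real_derivative \<xi>1 \<theta>) (at \<theta>)"
      "\<And>\<theta>. (\<xi>1 has_real_derivative \<xi>2 \<theta>) (at \<theta>)"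
      using log_C2_on_circle[OF h_C2 pos] by blast
    have "(\<lambda>\<theta>. ln (1 + h t (circ \<theta>))) = \<xi> t" by (simp add: fun_eq_iff xi_eq)
    with d exp_xi show ?thesis unfolding circle_domain_def by auto
  qed
  have chi_deriv: "\<exists>d. (chi t has_real_derivative d) (at \<theta>)" for t \<theta>
  proof -
    have "chi t = (\<lambda>\<theta>. \<psi> t (circ \<theta>))" by (simp add: fun_eq_iff chi_eq)
    then show ?thesis using psi_C2[of t] unfolding C2_on_circle_def by auto
  qed
  \<comment> \<open>The chain rule for ln gives one direction and that for exp the other;
    differentiability in t is part of each system, so it has to be transferred as well.\<close>
  have kinematic: "((\<lambda>t. h t (circ \<theta>)) has_real_derivative exp (\<xi> t \<theta>) * a) (at t)
      \<longleftrightarrow> ((\<lambda>t. \<xi> t \<theta>) has_real_derivative a) (at t)" for t \<theta> a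
  proof
    assume "((\<lambda>t. h t (circ \<theta>)) has_real_derivative exp (\<xi> t \<theta>) * a) (at t)"
    then have "((\<lambda>t. ln (1 + h t (circ \<theta>))) has_real_derivative exp (\<xi> t \<theta>) * a / exp (\<xi> t \<theta>)) (at t)"
      using pos[of t \<theta>] by (auto intro!: derivative_eq_intros simp: exp_xi[symmetric])
    then show "((\<lambda>t. \<xi> t \<theta>) has_real_derivative a) (at t)" by (simp add: xi_eq)
  next
    assume *: "((\<lambda>t. \<xi> t \<theta>) has_real_derivative a) (at t)"
    have "(\<lambda>t. h t (circ \<theta>)) = (\<lambda>t. exp (\<xi> t \<theta>) - 1)" by (simp add: fun_eq_iff flip: exp_xi)
    then show "((\<lambda>t. h t (circ \<theta>)) has_real_derivative exp (\<xi> t \<theta>) * a) (at t)"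
      by (auto intro!: derivative_eq_intros *)
  qed
  have chi_t: "(\<lambda>t. \<psi> t (circ \<theta>)) = (\<lambda>t. chi t \<theta>)" for \<theta> by (simp add: fun_eq_iff chi_eq)
  \<comment> \<open>The equivalence is pointwise in t and \<theta>: at fixed t the right-hand sides
    agree as numbers, up to the factor exp \<xi> that \<open>kinematic\<close> absorbs.\<close>
  have "?lhs t (circ \<theta>) \<longleftrightarrow> ?rhs t \<theta>" for t \<theta>
  proof -
    obtain \<xi>1 \<xi>2 where dom: "circle_domain (h t) (\<xi> t) \<xi>1" and d2: "(\<xi>1 has_real_derivative \<xi>2 \<theta>) (at \<theta>)"
      using domain[of t] by blast
    obtain chi' where dchi: "(chi t has_real_derivative chi') (at \<theta>)" using chi_deriv by blast
    show ?thesis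
      unfolding circle_domain.kinematic_rhs[OF dom, of "chi t" "\<psi> t", OF chi_eq]
        circle_domain.dynamic_rhs[OF dom, of "chi t" "\<psi> t", OF chi_eq dchi d2] kinematic chi_t ..
  qed
  then show ?thesis unfolding sphere_eq_range_circ by blast
qed

end
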